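(* (i) Let $0<q<1$ and $z\in\mathbb{C}\setminus\{0\}$. For $n\in\mathbb{N}$ define $e(n)$ by $$A_q(q^{-2n}z)=\frac{(-z)^n\left\{\theta_4(z^{-1};q)+e(n)\right\}}{(q;q)_\infty\, q^{n^2}}.$$ Then for all sufficiently large $n$, $$|e(n)|\le 4\,\theta_3(|z|^{-1};q)\left\{\frac{q^{n/2}}{1-q}+\frac{q^{\lfloor n/2\rfloor^2}}{|z|^{\lfloor n/2\rfloor}}\right\}.$$ (ii) Let $0<a<\frac12$ and $u\in\mathbb{R}$ be fixed, let $n\in\mathbb{N}$, and put $q=\exp(-\pi n^{-a})$. Then, as $n\to\infty$, $$A_q\left(-\exp 2\pi(u+n^{1-a})\right)=\frac{\exp\left\{\pi n^{-a}(n^a u+n)^2\right\}\left\{1+\mathcal{O}\left(\exp(-\pi n^a)\right)\right\}}{\sqrt2\,\exp\left\{\pi n^{-a}/24-\pi n^a/6\right\}},$$ and $$A_q\left(\exp 2\pi(u+n^{1-a})\right)=\frac{\sqrt2\,\exp\left\{\pi n^{-a}(n^a u+n)^2\right\}\left\{\cos(\pi n^a u)+\mathcal{O}\left(\exp(-2\pi n^a)\right)\right\}}{(-1)^n\exp\left\{\pi\left(n^a/12+n^{-a}/24\right)\right\}}.$$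
   Context: For $0<q<1$: $(c;q)_\infty=\prod_{k=0}^\infty(1-cq^k)$, $(c;q)_k=\prod_{j=0}^{k-1}(1-cq^j)$. Ramanujan's function is $A_q(z)=\sum_{k=0}^\infty\frac{q^{k^2}}{(q;q)_k}(-z)^k$, $z\in\mathbb{C}$. The theta functions are $\theta_3(z;q)=\sum_{k=-\infty}^\infty q^{k^2}z^k$ and $\theta_4(z;q)=\sum_{k=-\infty}^\infty(-1)^kq^{k^2}z^k$ for $z\in\mathbb{C}\setminus\{0\}$. $\lfloor x\rfloor$ is the greatest integer $\le x$. In (i) "sufficiently large" may depend on $q,z$. In (ii) $q$ depends on $n$, and the $\mathcal{O}$ terms are as $n\to\infty$ with $a,u$ fixed (implied constants may depend on $a,u$). *)

theory Defs
  imports "HOL-Analysis.Analysis" "HOL-Library.Landau_Symbols"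
begin

definition qpoch :: "'a::comm_ring_1 \<Rightarrow> 'a \<Rightarrow> nat \<Rightarrow> 'a" where
  "qpoch c q k = (\<Prod>j<k. 1 - c * q ^ j)"

definition qpoch_inf :: "'a::real_normed_field \<Rightarrow> 'a \<Rightarrow> 'a" where
  "qpoch_inf c q = (\<Prod>k. 1 - c * q ^ k)"

definition ramanujan_A :: "real \<Rightarrow> complex \<Rightarrow> complex" where
  "ramanujan_A q z = (\<Sum>k. complex_of_real (q ^ k\<^sup>2 / qpoch q q k) * (- z) ^ k)"

(* The bilateral theta series are unordered sums over the integers; for 0 < q < 1 and z \<noteq> 0
   they converge absolutely. They are polymorphic in the type of z so that a real argument
   yields a real value. *)
definition theta3 :: "'a::real_normed_field \<Rightarrow> real \<Rightarrow> 'a" where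
  "theta3 z q = (\<Sum>\<^sub>\<infinity>k\<in>(UNIV :: int set). of_real (q powi k\<^sup>2) * z powi k)"

definition theta4 :: "'a::real_normed_field \<Rightarrow> real \<Rightarrow> 'a" where
  "theta4 z q = (\<Sum>\<^sub>\<infinity>k\<in>(UNIV :: int set). (- 1) powi k * of_real (q powi k\<^sup>2) * z powi k)"

end

theory Submission
  imports Defs "HOL-Probability.Probability" "HOL-Real_Asymp.Real_Asymp"
begin

text \<open>Shifting the summation index by \<open>n\<close> turns \<open>A\<^sub>q(q\<^bsup>-2n\<^esup> z)\<close> into a bilateral theta series whose
  \<open>j\<close>-th term carries the factor \<open>(q\<^bsup>n+j+1\<^esup>; q)\<^sub>\<infinity>\<close>, read as \<open>0\<close> for \<open>j < -n\<close>. This factor is within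
  \<open>q\<^bsup>n+j+1\<^esup> / (1 - q)\<close> of \<open>1\<close>; splitting at \<open>j = -\<lfloor>n/2\<rfloor>\<close> gives part (i).
  For part (ii), Poisson summation for the Gaussian evaluates the theta functions, and also
  \<open>(q; q)\<^sub>\<infinity>\<close>, which the pentagonal number theorem writes as an alternating Gaussian sum.\<close>

section \<open>Bilateral sums and the pentagonal number theorem\<close>

text \<open>In part (ii) the base q changes with n, so an estimate of e(n) valid only beyond a
  threshold depending on q and z could not be inserted there. The bound on e(n) is therefore derived
  for every n, and the Gaussian asymptotics are uniform in N = n^a >= 1, where q = exp(-pi/N).
  Poisson summation replaces the parameter 1/N by N, so each series is governed by its lowest
  frequencies. The error relative to the leading amplitude is set by the first neglected nonzero
  term: exp(-pi N) for theta3 (frequencies 0 and 1), exp(-2 pi N) for theta4 (9/4 - 1/4), exp(-4 pi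
  N) for (q;q)_inf (25/6 - 1/6). The delicate case is theta4: its amplitude is smaller than theta3
  by a factor of order exp(-pi N/4), while e(n) is only controlled relative to theta3. The condition
  a < 1/2 provides the room: q^(n/2) = exp(-pi n^(1-a)/2) then beats every exp(-c n^a). Since the
  cosine can vanish, its error has to stay additive.\<close>

lemma abs_summable_on_bound:
  fixes g :: "'a \<Rightarrow> real"
  assumes "g summable_on A" "\<And>x. x \<in> A \<Longrightarrow> norm (f x) \<le> g x"
  shows "(\<lambda>x. norm (f x)) summable_on A"
proof (rule Infinite_Sum.abs_summable_on_comparison_test)
  have "g summable_on A \<longleftrightarrow> (\<lambda>x. norm (g x)) summable_on A"
    by (intro summable_on_cong) (metis assms(2) abs_of_nonneg norm_ge_zero order_trans real_norm_def)
  with assms show "(\<lambda>x. norm (g x)) summable_on A" by simp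
  show "norm (f x) \<le> norm (g x)" if "x \<in> A" for x
    using assms(2)[OF that] by simp
qed

lemma summable_on_bound:
  fixes g :: "'a \<Rightarrow> real" and f :: "'a \<Rightarrow> 'b :: banach"
  assumes "g summable_on A" "\<And>x. x \<in> A \<Longrightarrow> norm (f x) \<le> g x"
  shows "f summable_on A"
  using abs_summable_on_bound[OF assms] abs_summable_summable by blast

lemma summable_on_int:
  fixes f :: "int \<Rightarrow> 'a :: banach"
  assumes "(\<lambda>n. f (int n)) summable_on UNIV" "(\<lambda>n. f (- int n)) summable_on UNIV"
  shows "f summable_on UNIV"
proof -
  have "(\<lambda>n. f (int n)) summable_on UNIV \<longleftrightarrow> f summable_on {0..}"
    by (rule summable_on_reindex_bij_witness[of _ nat int]) auto
  moreover have "(\<lambda>n. f (- int n)) summable_on UNIV \<longleftrightarrow> f summable_on {..0}"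
    by (rule summable_on_reindex_bij_witness[of _ "\<lambda>k. nat (-k)" "\<lambda>n. - int n"]) auto
  moreover have "f summable_on {..<0}" if "f summable_on {..0}"
    by (rule summable_on_subset_banach[OF that]) auto
  ultimately have "f summable_on ({0..} \<union> {..<0})"
    using assms by (intro summable_on_Un_disjoint) auto
  also have "{0..} \<union> {..<0} = (UNIV :: int set)" by auto
  finally show ?thesis .
qed

lemma summable_on_exp_neg_abs: "(\<lambda>k::int. exp (- \<bar>real_of_int k\<bar>)) summable_on UNIV"
proof -
  have "(\<lambda>n. exp (- real n)) summable_on UNIV"
  proof (rule norm_summable_imp_summable_on)
    have "summable (\<lambda>n. exp (-1 :: real) ^ n)" by (rule summable_geometric) simp
    thus "summable (\<lambda>n. norm (exp (- real n)))"
      by (simp flip: exp_of_nat_mult)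
  qed
  thus ?thesis by (intro summable_on_int) simp_all
qed

lemma summable_on_exp_quadratic:
  fixes \<alpha> \<beta> :: real
  assumes "\<alpha> > 0"
  shows "(\<lambda>k::int. exp (- \<alpha> * real_of_int k ^ 2 + \<beta> * real_of_int k)) summable_on UNIV"
proof (rule summable_on_bound)
  \<comment> \<open>The exponent is the maximum of b*x - \<alpha>*x^2 with b = |\<beta>| + 1; the
    extra 1 in b is what leaves the summable factor exp(-|k|).\<close>
  let ?C = "exp ((\<bar>\<beta>\<bar> + 1)\<^sup>2 / (4 * \<alpha>))"
  show "(\<lambda>k::int. ?C * exp (- \<bar>real_of_int k\<bar>)) summable_on UNIV"
    by (intro summable_on_cmult_right summable_on_exp_neg_abs)
  fix k :: int
  let ?x = "\<bar>real_of_int k\<bar>" and ?b = "\<bar>\<beta>\<bar> + 1"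
  have "\<beta> * real_of_int k \<le> \<bar>\<beta>\<bar> * ?x" by (metis abs_ge_self abs_mult)
  moreover have "0 \<le> (2 * \<alpha> * ?x - ?b)\<^sup>2 / (4 * \<alpha>)" using assms by simp
  moreover have "(2 * \<alpha> * ?x - ?b)\<^sup>2 / (4 * \<alpha>) = \<alpha> * ?x\<^sup>2 - ?b * ?x + ?b\<^sup>2 / (4 * \<alpha>)"
    using assms by (simp add: power2_eq_square field_simps)
  ultimately have "- \<alpha> * real_of_int k ^ 2 + \<beta> * real_of_int k \<le> ?b\<^sup>2 / (4 * \<alpha>) - ?x"
    by (simp add: algebra_simps)
  thus "norm (exp (- \<alpha> * real_of_int k ^ 2 + \<beta> * real_of_int k)) \<le> ?C * exp (- ?x)"
    by (simp flip: exp_add)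
qed

text \<open>Both interval shapes occur later: half-open ones match the tiling of [-N, N) by unit
  intervals and the telescoping Fourier sums, closed ones match the partial sums in the pentagonal
  number theorem.\<close>

lemma has_sum_int_LIMSEQ:
  fixes f :: "int \<Rightarrow> 'a :: {comm_monoid_add,topological_space}"
  assumes "(f has_sum S) UNIV"
  shows "(\<lambda>N. \<Sum>k\<in>{- int N..<int N}. f k) \<longlonglongrightarrow> S"
    and "(\<lambda>N. \<Sum>k\<in>{- int N..int N}. f k) \<longlonglongrightarrow> S"
proof -
  \<comment> \<open>Any finite sets containing the open intervals eventually contain each finite set
    of integers, which handles both shapes at once.\<close>
  have *: "(\<lambda>N. sum f (I N)) \<longlonglongrightarrow> S"
    if "\<And>N. finite (I N)" "\<And>N. {- int N<..<int N} \<subseteq> I N" for I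
  proof (rule filterlim_compose[OF assms[unfolded has_sum_def]])
    show "filterlim I (finite_subsets_at_top UNIV) sequentially"
      unfolding filterlim_finite_subsets_at_top
    proof safe
      fix X :: "int set" assume "finite X"
      hence fin: "finite (abs ` X)" by simp
      let ?N = "nat (Max (insert 0 (abs ` X))) + 1"
      have "\<bar>x\<bar> < int N" if "N \<ge> ?N" "x \<in> X" for N x
      proof -
        have "\<bar>x\<bar> \<le> Max (insert 0 (abs ` X))" using fin that by (intro Max_ge) auto
        thus ?thesis using that by linarith
      qed
      hence "X \<subseteq> I N" if "N \<ge> ?N" for N
        using that(1) \<open>\<And>N. {- int N<..<int N} \<subseteq> I N\<close>[of N] by (force simp: abs_less_iff)
      thus "\<forall>\<^sub>F N in sequentially. finite (I N) \<and> X \<subseteq> I N \<and> I N \<subseteq> UNIV"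
        using that(1) by (intro eventually_sequentiallyI[of ?N]) blast
    qed
  qed
  show "(\<lambda>N. \<Sum>k\<in>{- int N..<int N}. f k) \<longlonglongrightarrow> S" by (rule *) auto
  show "(\<lambda>N. \<Sum>k\<in>{- int N..int N}. f k) \<longlonglongrightarrow> S" by (rule *) auto
qed

section \<open>Estimates for the product (q;q)_k and its limit\<close>

lemma qpoch_0 [simp]: "qpoch c q 0 = 1"
  by (simp add: qpoch_def)

lemma qpoch_Suc: "qpoch c q (Suc k) = qpoch c q k * (1 - c * q ^ k)"
  by (simp add: qpoch_def)

context
  fixes q :: real
  assumes q: "0 < q" "q < 1"
begin

lemma qpoch_self_pos: "qpoch q q n > 0"
proof (induction n)
  case (Suc n)
  have "q * q ^ n < 1" using q power_Suc_less_one[of q n] by simp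
  with Suc show ?case by (simp add: qpoch_Suc)
qed simp

lemma qpoch_self_decseq: "decseq (qpoch q q)"
proof (rule decseq_SucI)
  fix n
  show "qpoch q q (Suc n) \<le> qpoch q q n"
    unfolding qpoch_Suc using q qpoch_self_pos[of n]
    by (intro mult_left_le) auto
qed

text \<open>Weierstrass' inequality, a product of factors 1 - x_j is at least 1 minus the sum of the
  x_j, applied to the factors after the first m. The fraction is the geometric sum q^(m+1) + ... +
  q^(m+i).\<close>

lemma qpoch_self_lower:
  "qpoch q q m * (1 - (q ^ Suc m - q ^ Suc (m + i)) / (1 - q)) \<le> qpoch q q (m + i)"
proof (induction i)
  case (Suc i)
  let ?s = "(q ^ Suc m - q ^ Suc (m + i)) / (1 - q)" and ?x = "q ^ Suc (m + i)"
  have "?s \<ge> 0" using q by (intro divide_nonneg_nonneg) (auto intro!: power_decreasing mult_left_mono)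
  have *: "(1 - a) * (1 - b) = 1 - a - b + a * b" for a b :: real by algebra
  have x: "0 \<le> ?x" "?x \<le> 1" using q by (auto intro!: power_le_one mult_le_one)
  have "(q ^ Suc m - q ^ Suc (m + Suc i)) / (1 - q) = ?s + ?x"
    using q by (simp add: field_simps)
  hence "qpoch q q m * (1 - (q ^ Suc m - q ^ Suc (m + Suc i)) / (1 - q)) =
         qpoch q q m * (1 - ?s - ?x)" by simp
  also have "\<dots> \<le> qpoch q q m * ((1 - ?s) * (1 - ?x))"
    using qpoch_self_pos[of m] mult_nonneg_nonneg[OF \<open>?s \<ge> 0\<close> x(1)]
    unfolding * by (intro mult_left_mono) simp_all
  also have "\<dots> = (qpoch q q m * (1 - ?s)) * (1 - ?x)" by simp
  also have "\<dots> \<le> qpoch q q (m + i) * (1 - ?x)"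
    using Suc x by (intro mult_right_mono) auto
  finally show ?case by (simp add: qpoch_Suc)
qed simp

lemma convergent_prod_qpoch_self: "convergent_prod (\<lambda>k. 1 - q * q ^ k)"
proof -
  have "convergent_prod (\<lambda>k. 1 + (- (q * q ^ k)))"
  proof (rule summable_imp_convergent_prod_real)
    have "summable (\<lambda>k. q * q ^ k)" using q by (intro summable_mult summable_geometric) auto
    thus "summable (\<lambda>k. \<bar>- (q * q ^ k)\<bar>)" using q by (simp add: abs_mult)
    show "- (q * q ^ k) \<noteq> - 1" for k using q power_Suc_less_one[of q k] by simp
  qed
  thus ?thesis by simp
qed

lemma qpoch_self_LIMSEQ: "qpoch q q \<longlonglongrightarrow> qpoch_inf q q"
  using convergent_prod_LIMSEQ[OF convergent_prod_qpoch_self]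
  by (simp add: qpoch_def [abs_def] qpoch_inf_def LIMSEQ_lessThan_iff_atMost)

lemma qpoch_inf_pos: "qpoch_inf q q > 0"
proof -
  have "qpoch_inf q q \<noteq> 0"
    unfolding qpoch_inf_def
  proof (rule prodinf_nonzero[OF convergent_prod_qpoch_self])
    show "1 - q * q ^ k \<noteq> 0" for k using q power_Suc_less_one[of q k] by simp
  qed
  moreover have "qpoch_inf q q \<ge> 0"
    by (rule LIMSEQ_le_const[OF qpoch_self_LIMSEQ]) (auto intro: less_imp_le qpoch_self_pos)
  ultimately show ?thesis by simp
qed

text \<open>The quotient is the tail product (q^(m+1); q)_inf, written so that only one infinite
  product occurs. The upper bound is monotonicity of the finite products; the lower one is
  \<open>qpoch_self_lower\<close> in the limit, with the geometric sum enlarged to the full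
  series.\<close>

lemma qpoch_inf_ratio:
  "qpoch_inf q q / qpoch q q m \<le> 1" "1 - q ^ Suc m / (1 - q) \<le> qpoch_inf q q / qpoch q q m"
proof -
  have "qpoch_inf q q \<le> qpoch q q m"
    by (rule decseq_ge[OF qpoch_self_decseq qpoch_self_LIMSEQ])
  thus "qpoch_inf q q / qpoch q q m \<le> 1" using qpoch_self_pos[of m] by simp
  have "qpoch q q m * (1 - q ^ Suc m / (1 - q)) \<le> qpoch_inf q q"
  proof (rule LIMSEQ_le_const[OF LIMSEQ_ignore_initial_segment[OF qpoch_self_LIMSEQ, of m]])
    have "qpoch q q m * (1 - q ^ Suc m / (1 - q)) \<le> qpoch q q (i + m)" for i
    proof -
      have "qpoch q q m * (1 - q ^ Suc m / (1 - q)) \<le>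
              qpoch q q m * (1 - (q ^ Suc m - q ^ Suc (m + i)) / (1 - q))"
        using q qpoch_self_pos[of m] by (intro mult_left_mono diff_left_mono divide_right_mono) auto
      also have "\<dots> \<le> qpoch q q (i + m)"
        using qpoch_self_lower[of m i] by (simp only: add.commute)
      finally show ?thesis .
    qed
    thus "\<exists>N. \<forall>n\<ge>N. qpoch q q m * (1 - q ^ Suc m / (1 - q)) \<le> qpoch q q (n + m)" by blast
  qed
  thus "1 - q ^ Suc m / (1 - q) \<le> qpoch_inf q q / qpoch q q m"
    using qpoch_self_pos[of m] by (simp add: field_simps)
qed

end

text \<open>Shanks' finite form of the pentagonal number theorem; \<open>q = r\<^sup>2\<close> keeps all exponents integral.\<close>

lemma shanks_identity:
  fixes r :: real
  assumes r: "0 < r" "r < 1"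
  shows "(\<Sum>s\<le>n. (-1) ^ s * (qpoch (r\<^sup>2) (r\<^sup>2) n / qpoch (r\<^sup>2) (r\<^sup>2) s) * r ^ (2 * s * n + s * (s + 1)))
       = 1 + (\<Sum>j<n. (-1) ^ Suc j * (r ^ (Suc j * (3 * j + 4)) + r ^ (Suc j * (3 * j + 2))))"
proof (induction n)
  case (Suc n)
  define P where "P = qpoch (r\<^sup>2) (r\<^sup>2)"
  have P0: "P k \<noteq> 0" for k
    unfolding P_def using qpoch_self_pos[of "r\<^sup>2" k] r by (simp add: power_less_one_iff)
  have PSuc: "P (Suc k) = P k * (1 - r ^ (2 * k + 2))" for k
    by (simp add: P_def qpoch_Suc power_mult power2_eq_square power_add)
  \<comment> \<open>Antidifference in s: passing from n to n + 1 changes the summand with index s by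
    X(s-1) - X(s), where X(-1) counts as 0. The sum over s <= n therefore changes by -X(n)
    alone.\<close>
  define X where "X s = (-1) ^ s * (P n / P s) * r ^ (2 * s * n + 2 * n + 2 + s * (s + 3))" for s
  have tele: "(-1) ^ s * (P (Suc n) / P s) * r ^ (2 * s * Suc n + s * (s + 1))
      - (-1) ^ s * (P n / P s) * r ^ (2 * s * n + s * (s + 1))
      = (if s = 0 then 0 else X (s - 1)) - X s" for s
  proof (cases s)
    case 0
    show ?thesis unfolding 0 X_def using P0[of 0] by (simp add: PSuc field_simps)
  next
    case (Suc k)
    have r1: "1 - r ^ (2 * k + 2) \<noteq> 0" using P0[of "Suc k"] by (simp add: PSuc)
    have e1: "r ^ (2 * s * Suc n + s * (s + 1)) = r ^ (2 * s * n + s * (s + 1)) * r ^ (2 * k + 2)"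
      unfolding power_add[symmetric] by (rule arg_cong[of _ _ "power r"]) (simp add: Suc algebra_simps)
    have e2: "r ^ (2 * s * n + 2 * n + 2 + s * (s + 3)) =
        r ^ (2 * s * n + s * (s + 1)) * r ^ (2 * k + 2) * r ^ (2 * n + 2)"
      unfolding power_add[symmetric] by (rule arg_cong[of _ _ "power r"]) (simp add: Suc algebra_simps)
    have e3: "r ^ (2 * k * n + 2 * n + 2 + k * (k + 3)) = r ^ (2 * s * n + s * (s + 1))"
      unfolding Suc by (simp add: algebra_simps)
    define R where "R = r ^ (2 * s * n + s * (s + 1))"
    define y where "y = r ^ (2 * k + 2)"
    define w where "w = r ^ (2 * n + 2)"
    have Xk: "X (s - 1) = (-1) ^ k * (P n / P k) * R"
      using e3 by (simp add: X_def R_def Suc)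
    have Xs: "X s = - ((-1) ^ k) * (P n / (P k * (1 - y))) * (R * y * w)"
      unfolding X_def e2 using Suc by (simp add: R_def y_def w_def PSuc)
    have y1: "1 - y \<noteq> 0" using r1 by (simp add: y_def)
    have *: "(if s = 0 then 0 else X (s - 1)) = X (s - 1)" using Suc by simp
    show ?thesis unfolding * Xk Xs e1 using P0[of k] y1
      unfolding Suc PSuc[of n] PSuc[of k] R_def[symmetric, unfolded Suc] y_def[symmetric] w_def[symmetric]
      by (simp add: divide_simps) (simp add: algebra_simps)
  qed
  have sumtele: "(\<Sum>s\<le>m. (if s = 0 then 0 else X (s - 1)) - X s) = - X m" for m
    by (induction m) auto
  have "(\<Sum>s\<le>n. (-1) ^ s * (P (Suc n) / P s) * r ^ (2 * s * Suc n + s * (s + 1)))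
      - (\<Sum>s\<le>n. (-1) ^ s * (P n / P s) * r ^ (2 * s * n + s * (s + 1))) = - X n"
    unfolding sum_subtractf[symmetric] tele sumtele ..
  \<comment> \<open>The two new pentagonal terms have different origins: exponent (n+1)(3n+2) is the
    boundary value X(n), exponent (n+1)(3n+4) is the additional summand s = n + 1.\<close>
  hence "(\<Sum>s\<le>Suc n. (-1) ^ s * (P (Suc n) / P s) * r ^ (2 * s * Suc n + s * (s + 1)))
      = (\<Sum>s\<le>n. (-1) ^ s * (P n / P s) * r ^ (2 * s * n + s * (s + 1))) - X n
        + (-1) ^ Suc n * r ^ (2 * Suc n * Suc n + Suc n * (Suc n + 1))"
    unfolding sum.atMost_Suc divide_self[OF P0] by linarith
  also have "X n = (-1) ^ n * r ^ (Suc n * (3 * n + 2))"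
    using P0[of n] by (simp add: X_def algebra_simps)
  also have "2 * Suc n * Suc n + Suc n * (Suc n + 1) = Suc n * (3 * n + 4)"
    by (simp add: algebra_simps)
  finally show ?case using Suc.IH by (simp add: P_def algebra_simps)
qed simp

text \<open>In Shanks' sum the summand s = 0 is the finite product itself, and each of the n others
  is at most (r^2)^n in absolute value. Symmetric partial sums of the series and finite products
  therefore differ by at most n r^(2n) and share their limit.\<close>

theorem pentagonal_number:
  fixes r :: real
  assumes r: "0 < r" "r < 1"
  shows "((\<lambda>k::int. (-1) powi k * r powi (k * (3 * k - 1))) has_sum qpoch_inf (r\<^sup>2) (r\<^sup>2)) UNIV"
proof -
  define b where "b k = (-1) powi k * r powi (k * (3 * k - 1))" for k :: int
  define P where "P = qpoch (r\<^sup>2) (r\<^sup>2)"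
  have q: "0 < r\<^sup>2" "r\<^sup>2 < 1" using r by (auto simp: power_less_one_iff)
  have P: "P n > 0" for n unfolding P_def by (rule qpoch_self_pos[OF q])
  define F where "F n = (\<Sum>s\<le>n. (-1) ^ s * (P n / P s) * r ^ (2 * s * n + s * (s + 1)))" for n
  have summ: "b summable_on UNIV"
  proof (rule summable_on_bound)
    let ?c = "- ln r"
    show "(\<lambda>k::int. exp (- (3 * ?c) * real_of_int k ^ 2 + ?c * real_of_int k)) summable_on UNIV"
      using r by (intro summable_on_exp_quadratic) auto
    show "norm (b k) \<le> exp (- (3 * ?c) * real_of_int k ^ 2 + ?c * real_of_int k)" for k
    proof -
      have "norm (b k) = r powr (real_of_int (k * (3 * k - 1)))"
        using r unfolding b_def by (subst powr_real_of_int') (simp_all add: abs_mult flip: power_int_abs)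
      also have "\<dots> = exp (- (3 * ?c) * real_of_int k ^ 2 + ?c * real_of_int k)"
        using r by (simp add: powr_def power2_eq_square algebra_simps)
      finally show ?thesis by simp
    qed
  qed
  have partial: "(\<Sum>k\<in>{- int n..int n}. b k) = F n" for n
  proof -
    have "(\<Sum>k\<in>{- int n..int n}. b k) =
       1 + (\<Sum>j<n. (-1) ^ Suc j * (r ^ (Suc j * (3 * j + 4)) + r ^ (Suc j * (3 * j + 2))))"
    proof (induction n)
      case (Suc n)
      have "{- int (Suc n)..int (Suc n)} = insert (- int (Suc n)) (insert (int (Suc n)) {- int n..int n})"
        by auto
      hence "(\<Sum>k\<in>{- int (Suc n)..int (Suc n)}. b k) =
          b (- int (Suc n)) + (b (int (Suc n)) + (\<Sum>k\<in>{- int n..int n}. b k))" by simp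
      also have "b (int (Suc n)) = (-1) ^ Suc n * r ^ (Suc n * (3 * n + 2))"
      proof -
        have *: "int (Suc n) * (3 * int (Suc n) - 1) = int (Suc n * (3 * n + 2))"
          by (simp add: algebra_simps)
        show ?thesis unfolding b_def * power_int_of_nat ..
      qed
      also have "b (- int (Suc n)) = (-1) ^ Suc n * r ^ (Suc n * (3 * n + 4))"
      proof -
        have *: "- int (Suc n) * (3 * - int (Suc n) - 1) = int (Suc n * (3 * n + 4))"
          by (simp add: algebra_simps)
        have "(-1::real) powi (- int (Suc n)) = (-1) ^ Suc n"
          by (simp only: power_int_minus power_int_of_nat) (simp flip: power_inverse)
        thus ?thesis unfolding b_def * power_int_of_nat by simp
      qed
      finally show ?case using Suc by (simp add: algebra_simps)
    qed (simp add: b_def)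
    thus ?thesis unfolding F_def P_def shanks_identity[OF r] .
  qed
  have "(\<lambda>n. F n - P n) \<longlonglongrightarrow> 0"
  proof (rule Lim_null_comparison)
    show "(\<lambda>n. real n * (r\<^sup>2) ^ n) \<longlonglongrightarrow> 0" using q by (intro powser_times_n_limit_0) auto
    have "norm (F n - P n) \<le> real n * (r\<^sup>2) ^ n" for n
    proof -
      have F: "F n = P n + (\<Sum>s\<in>{1..n}. (-1) ^ s * (P n / P s) * r ^ (2 * s * n + s * (s + 1)))"
      proof -
        have "{..n} = insert 0 {1..n}" by auto
        thus ?thesis unfolding F_def by (simp add: P_def)
      qed
      have "norm (F n - P n) \<le> (\<Sum>s\<in>{1..n}. norm ((-1) ^ s * (P n / P s) * r ^ (2 * s * n + s * (s + 1))))"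
        unfolding F by (simp only: add_diff_cancel_left') (rule norm_sum)
      also have "\<dots> \<le> (\<Sum>s\<in>{1..n}. 1 * (r\<^sup>2) ^ n)"
      proof (rule sum_mono)
        fix s assume s: "s \<in> {1..n}"
        have "P n \<le> P s" using decseqD[OF qpoch_self_decseq[OF q]] s by (simp add: P_def)
        hence 1: "P n / P s \<le> 1" "P n / P s > 0" using P[of s] P[of n] by simp_all
        have "2 * n \<le> 2 * s * n + s * (s + 1)" using s by (simp add: trans_le_add1)
        hence "r ^ (2 * s * n + s * (s + 1)) \<le> r ^ (2 * n)" using r by (intro power_decreasing) auto
        hence "(P n / P s) * r ^ (2 * s * n + s * (s + 1)) \<le> 1 * (r\<^sup>2) ^ n"
          using 1 r unfolding power_mult[symmetric] by (intro mult_mono) auto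
        moreover have "norm ((-1) ^ s * (P n / P s) * r ^ (2 * s * n + s * (s + 1))) =
            (P n / P s) * r ^ (2 * s * n + s * (s + 1))"
          using P[of s] P[of n] r by (simp add: abs_mult)
        ultimately show "norm ((-1) ^ s * (P n / P s) * r ^ (2 * s * n + s * (s + 1))) \<le> 1 * (r\<^sup>2) ^ n"
          by simp
      qed
      finally show ?thesis by simp
    qed
    thus "\<forall>\<^sub>F n in sequentially. norm (F n - P n) \<le> real n * (r\<^sup>2) ^ n" by simp
  qed
  from tendsto_add[OF this qpoch_self_LIMSEQ[OF q, folded P_def]]
  have "F \<longlonglongrightarrow> qpoch_inf (r\<^sup>2) (r\<^sup>2)" by simp
  moreover have "F \<longlonglongrightarrow> infsum b UNIV"
    using has_sum_int_LIMSEQ(2)[OF has_sum_infsum[OF summ]] by (simp add: partial)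
  ultimately have "infsum b UNIV = qpoch_inf (r\<^sup>2) (r\<^sup>2)" by (metis LIMSEQ_unique)
  with summ show ?thesis using has_sum_infsum[OF summ] by (simp add: b_def [abs_def])
qed

section \<open>Poisson summation for the Gaussian\<close>

text \<open>Only averages of the Fourier partial sums will be shown to tend to 0. As the sums
  themselves are known to converge, this identifies their limit.\<close>

lemma LIMSEQ_Cesaro:
  fixes X :: "nat \<Rightarrow> 'a :: real_normed_vector"
  assumes "X \<longlonglongrightarrow> S"
  shows "(\<lambda>M. (\<Sum>n<M. X n) /\<^sub>R real M) \<longlonglongrightarrow> S"
proof (rule LIMSEQ_I)
  fix e :: real assume "e > 0"
  obtain N where N: "\<And>n. n \<ge> N \<Longrightarrow> norm (X n - S) < e / 2"
    using LIMSEQ_D[OF assms, of "e / 2"] \<open>e > 0\<close> by auto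
  define K where "K = (\<Sum>n<N. norm (X n - S))"
  have main: "norm ((\<Sum>n<M. X n) /\<^sub>R real M - S) < e" if M: "M > 0" "M \<ge> N" "real M > 2 * K / e" for M
  proof -
    have "(\<Sum>n<M. X n) /\<^sub>R real M - S = (\<Sum>n<M. X n - S) /\<^sub>R real M"
      using M by (simp add: sum_subtractf scaleR_diff_right sum_constant_scaleR del: sum_constant)
    also have "norm \<dots> \<le> (\<Sum>n<M. norm (X n - S)) / real M"
      using norm_sum[of "\<lambda>n. X n - S" "{..<M}"] M by (simp add: inverse_eq_divide mult.commute[of "inverse _"] divide_right_mono)
    also have "\<dots> < e"
    proof -
      have M_eq: "{..<M} = {..<N} \<union> {N..<M}" using M(2) by auto
      have "(\<Sum>n<M. norm (X n - S)) = K + (\<Sum>n\<in>{N..<M}. norm (X n - S))"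
        unfolding K_def M_eq by (rule sum.union_disjoint) auto
      also have "(\<Sum>n\<in>{N..<M}. norm (X n - S)) \<le> (\<Sum>n\<in>{N..<M}. e / 2)"
        using N by (intro sum_mono) (auto intro: less_imp_le)
      also have "\<dots> \<le> real M * (e / 2)" using \<open>e > 0\<close> by simp
      also have "K < real M * (e / 2)" using M(3) \<open>e > 0\<close> by (simp add: field_simps)
      finally show ?thesis using M(1) by (simp add: field_simps)
    qed
    finally show ?thesis .
  qed
  obtain M0 where M0: "real M0 > 2 * K / e" using reals_Archimedean2 by blast
  show "\<exists>M0. \<forall>M\<ge>M0. norm ((\<Sum>n<M. X n) /\<^sub>R real M - S) < e"
  proof (intro exI[of _ "max (Suc N) M0"] allI impI main)
    fix M assume M: "max (Suc N) M0 \<le> M"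
    thus "0 < M" "N \<le> M" by linarith+
    have "real M0 \<le> real M" using M by simp
    thus "2 * K / e < real M" using M0 by linarith
  qed
qed

text \<open>Unfolding: the interval [-N, N) is tiled by integer translates of [0, 1), and the pieces
  are moved back to [0, 1). Then N tends to infinity by dominated convergence on both sides, with
  |f| as majorant on the line and the uniform bound \<open>C\<close> on the unit interval.\<close>

lemma integral_periodization:
  fixes f :: "real \<Rightarrow> complex"
  assumes f: "integrable lborel f"
    and lim: "\<And>y. y \<in> {0..<1} \<Longrightarrow> (\<lambda>N. \<Sum>k\<in>{- int N..<int N}. f (y + of_int k)) \<longlonglongrightarrow> F y"
    and bound: "\<And>y N. y \<in> {0..<1} \<Longrightarrow> norm (\<Sum>k\<in>{- int N..<int N}. f (y + of_int k)) \<le> C"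
    and [measurable]: "F \<in> borel_measurable borel"
  shows "(\<integral>y. indicator {0..<1} y *\<^sub>R F y \<partial>lborel) = (\<integral>y. f y \<partial>lborel)"
proof -
  have [measurable]: "f \<in> borel_measurable borel" using f by auto
  have fi: "integrable lborel (\<lambda>y. f (y + of_int k))" for k
    using lborel_integrable_real_affine[OF f, of 1 "of_int k"] by (simp add: add.commute)
  have ind: "(\<Sum>k\<in>{- int N..<int N}. indicator {of_int k..<of_int k + 1} y) = (indicator {- real N..<real N} y :: real)"
    for N and y :: real
  proof -
    have "(\<Sum>k\<in>{- int N..<int N}. indicator {of_int k..<of_int k + 1} y) =
        (\<Sum>k\<in>{- int N..<int N}. if k = \<lfloor>y\<rfloor> then 1 else (0::real))"
    proof (intro sum.cong refl)
      fix k
      have "of_int k \<le> y \<and> y < of_int k + 1 \<longleftrightarrow> k = \<lfloor>y\<rfloor>"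
        by (metis floor_eq_iff)
      thus "indicator {of_int k..<of_int k + 1} y = (if k = \<lfloor>y\<rfloor> then 1 else (0::real))"
        by (simp add: indicator_def)
    qed
    also have "\<dots> = (if \<lfloor>y\<rfloor> \<in> {- int N..<int N} then 1 else 0)" by simp
    also have "\<dots> = indicator {- real N..<real N} y"
      by (auto simp: indicator_def le_floor_iff floor_less_iff)
    finally show ?thesis .
  qed
  have eq: "(\<integral>y. indicator {- real N..<real N} y *\<^sub>R f y \<partial>lborel) =
      (\<integral>y. indicator {0..<1} y *\<^sub>R (\<Sum>k\<in>{- int N..<int N}. f (y + of_int k)) \<partial>lborel)" for N
  proof -
    have "(\<integral>y. indicator {- real N..<real N} y *\<^sub>R f y \<partial>lborel) =
        (\<integral>y. (\<Sum>k\<in>{- int N..<int N}. indicator {of_int k..<of_int k + 1} y *\<^sub>R f y) \<partial>lborel)"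
      by (simp only: ind[symmetric] scaleR_sum_left)
    also have "\<dots> = (\<Sum>k\<in>{- int N..<int N}. \<integral>y. indicator {of_int k..<of_int k + 1} y *\<^sub>R f y \<partial>lborel)"
      by (intro Bochner_Integration.integral_sum integrable_mult_indicator f) auto
    also have "\<dots> = (\<Sum>k\<in>{- int N..<int N}. \<integral>y. indicator {0..<1} y *\<^sub>R f (y + of_int k) \<partial>lborel)"
    proof (rule sum.cong[OF refl])
      fix k
      show "(\<integral>y. indicator {of_int k..<of_int k + 1} y *\<^sub>R f y \<partial>lborel) =
          (\<integral>y. indicator {0..<1} y *\<^sub>R f (y + of_int k) \<partial>lborel)"
      proof (subst lborel_integral_real_affine[of 1 _ "of_int k"])
        have "indicator {of_int k..<of_int k + 1} (of_int k + 1 * y) = (indicator {0..<1} y :: real)" for y :: real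
          by (simp add: indicator_def)
        thus "\<bar>1\<bar> *\<^sub>R (\<integral>y. indicator {of_int k..<of_int k + 1} (of_int k + 1 * y) *\<^sub>R f (of_int k + 1 * y) \<partial>lborel) =
            (\<integral>y. indicator {0..<1} y *\<^sub>R f (y + of_int k) \<partial>lborel)"
          by (simp add: add.commute)
      qed simp
    qed
    also have "\<dots> = (\<integral>y. (\<Sum>k\<in>{- int N..<int N}. indicator {0..<1} y *\<^sub>R f (y + of_int k)) \<partial>lborel)"
      by (intro Bochner_Integration.integral_sum[symmetric] integrable_mult_indicator fi) auto
    finally show ?thesis by (simp only: scaleR_sum_right)
  qed
  have "(\<lambda>N. \<integral>y. indicator {- real N..<real N} y *\<^sub>R f y \<partial>lborel) \<longlonglongrightarrow> (\<integral>y. f y \<partial>lborel)"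
  proof (rule integral_dominated_convergence[where w = "\<lambda>y. norm (f y)"])
    show "AE y in lborel. (\<lambda>N. indicator {- real N..<real N} y *\<^sub>R f y) \<longlonglongrightarrow> f y"
    proof (rule AE_I2)
      fix y
      obtain N0 where "real N0 > \<bar>y\<bar>" using reals_Archimedean2 by blast
      hence "\<forall>\<^sub>F N in sequentially. indicator {- real N..<real N} y *\<^sub>R f y = f y"
        by (intro eventually_sequentiallyI[of N0]) (auto simp: indicator_def)
      thus "(\<lambda>N. indicator {- real N..<real N} y *\<^sub>R f y) \<longlonglongrightarrow> f y"
        by (rule tendsto_eventually)
    qed
    show "AE y in lborel. norm (indicator {- real N..<real N} y *\<^sub>R f y) \<le> norm (f y)" for N
      by (rule AE_I2) (simp add: indicator_def)
    show "integrable lborel (\<lambda>y. norm (f y))" using f by (rule integrable_norm)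
  qed measurable
  moreover have "(\<lambda>N. \<integral>y. indicator {0..<1} y *\<^sub>R (\<Sum>k\<in>{- int N..<int N}. f (y + of_int k)) \<partial>lborel)
      \<longlonglongrightarrow> (\<integral>y. indicator {0..<1} y *\<^sub>R F y \<partial>lborel)"
  proof (rule integral_dominated_convergence[where w = "\<lambda>y. indicator {0..<1} y *\<^sub>R C"])
    show "integrable lborel (\<lambda>y::real. indicator {0..<1} y *\<^sub>R C)"
      by (intro integrable_scaleR_left) auto
    show "AE y in lborel. (\<lambda>N. indicator {0..<1} y *\<^sub>R (\<Sum>k\<in>{- int N..<int N}. f (y + of_int k)))
        \<longlonglongrightarrow> indicator {0..<1} y *\<^sub>R F y"
    proof (rule AE_I2)
      fix y :: real
      show "(\<lambda>N. indicator {0..<1} y *\<^sub>R (\<Sum>k\<in>{- int N..<int N}. f (y + of_int k)))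
          \<longlonglongrightarrow> indicator {0..<1} y *\<^sub>R F y"
        by (cases "y \<in> {0..<1}") (simp_all add: lim)
    qed
    show "AE y in lborel. norm (indicator {0..<1} y *\<^sub>R (\<Sum>k\<in>{- int N..<int N}. f (y + of_int k)))
        \<le> indicator {0..<1} y *\<^sub>R C" for N
    proof (rule AE_I2)
      fix y :: real
      show "norm (indicator {0..<1} y *\<^sub>R (\<Sum>k\<in>{- int N..<int N}. f (y + of_int k)))
          \<le> indicator {0..<1} y *\<^sub>R C"
        by (cases "y \<in> {0..<1}")
           (simp_all add: bound)
    qed
  qed measurable
  ultimately show ?thesis unfolding eq by (rule LIMSEQ_unique[rotated])
qed

lemma sin_ge_half:
  assumes "0 \<le> x" "x \<le> pi / 2"
  shows "x / 2 \<le> sin (x::real)"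
proof -
  have "\<bar>sin x - (\<Sum>m<3. sin_coeff m * x ^ m)\<bar> \<le> inverse (fact 3) * \<bar>x\<bar> ^ 3"
    by (rule Maclaurin_sin_bound)
  hence "\<bar>sin x - x\<bar> \<le> x ^ 3 / 6"
    using assms by (simp add: eval_nat_numeral sin_coeff_def fact_numeral)
  \<comment> \<open>1.6 exceeds pi/2, and x^2 <= 3 is all that x - x^3/6 >= x/2 requires.\<close>
  moreover have "x ^ 2 \<le> 1.6 ^ 2"
    using assms pi_less_4 pi_approx by (intro power_mono) auto
  hence "x * (x ^ 2) \<le> x * 3" using assms by (intro mult_left_mono) (simp_all add: power2_eq_square)
  moreover have "x ^ 3 = x * x ^ 2" by (simp add: eval_nat_numeral)
  ultimately show ?thesis by linarith
qed

text \<open>Shows that the denominator in Chernoff's quotient vanishes only to first order at both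
  ends of the period, so that a Lipschitz numerator vanishing there keeps the quotient bounded. The
  chord length is 2 sin(pi y), and the reflection y -> 1 - y covers the second half.\<close>

lemma norm_cis_minus_1_ge:
  assumes "0 \<le> y" "y \<le> 1"
  shows "norm (cis (2 * pi * y) - 1) \<ge> pi * min y (1 - y)"
proof -
  have "norm (cis (2 * pi * y) - 1) = 2 * \<bar>sin (pi * y)\<bar>"
    using dist_exp_i_1[of "2 * pi * y"] by (simp add: cis_conv_exp)
  moreover have "sin (pi * y) \<ge> pi * min y (1 - y) / 2"
  proof (cases "y \<le> 1 / 2")
    case True
    thus ?thesis using assms sin_ge_half[of "pi * y"] by (simp add: min_def)
  next
    case False
    have "sin (pi * y) = sin (pi * (1 - y))" by (simp add: right_diff_distrib)
    thus ?thesis using False assms sin_ge_half[of "pi * (1 - y)"] by (simp add: min_def)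
  qed
  ultimately show ?thesis by linarith
qed

text \<open>The geometric sums stay bounded by 2/|w - 1|, so division by M sends them to 0.\<close>

lemma tendsto_mean_unit_powers:
  fixes w :: complex
  assumes "norm w = 1" "w \<noteq> 1"
  shows "(\<lambda>M. (\<Sum>n<M. w ^ n) /\<^sub>R real M) \<longlonglongrightarrow> 0"
proof (rule Lim_null_comparison)
  show "(\<lambda>M. 2 / norm (w - 1) * (1 / real M)) \<longlonglongrightarrow> 0"
    using tendsto_mult_right_zero[OF lim_1_over_n] by blast
  have "norm ((\<Sum>n<M. w ^ n) /\<^sub>R real M) \<le> 2 / norm (w - 1) * (1 / real M)" for M
  proof -
    have "norm (w ^ M - 1) \<le> norm (w ^ M) + norm (1::complex)" by (rule norm_triangle_ineq4)
    hence "norm (w ^ M - 1) \<le> 2" using assms by (simp add: norm_power)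
    hence "norm (\<Sum>n<M. w ^ n) \<le> 2 / norm (w - 1)"
      using assms by (simp add: geometric_sum norm_divide divide_right_mono)
    hence "norm (\<Sum>n<M. w ^ n) * (1 / real M) \<le> 2 / norm (w - 1) * (1 / real M)"
      by (intro mult_right_mono) auto
    thus ?thesis by (simp add: divide_inverse mult.commute)
  qed
  thus "\<forall>\<^sub>F M in sequentially. norm ((\<Sum>n<M. w ^ n) /\<^sub>R real M) \<le> 2 / norm (w - 1) * (1 / real M)"
    by simp
qed

text \<open>Chernoff's argument: dividing \<open>h\<close> by \<open>cis (2 * pi * y) - 1\<close> makes the Fourier partial sums
  telescope; averaging them replaces the Riemann--Lebesgue lemma.\<close>

lemma fourier_partial_sums_at_zero:
  fixes h :: "real \<Rightarrow> complex"
  defines "c \<equiv> \<lambda>m::int. \<integral>y. indicator {0..<1} y *\<^sub>R (h y * cis (- (2 * pi * of_int m * y))) \<partial>lborel"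
  assumes h [measurable]: "h \<in> borel_measurable borel"
    and bound: "\<And>y. 0 \<le> y \<Longrightarrow> y \<le> 1 \<Longrightarrow> norm (h y) \<le> L * min y (1 - y)"
    and lim: "(\<lambda>N. \<Sum>m\<in>{- int N..<int N}. c m) \<longlonglongrightarrow> S"
  shows "S = 0"
proof -
  \<comment> \<open>At y = 0 the denominator is 0 and division by zero gives g 0 = 0, so the bound
    on \<open>g\<close>, the identity for \<open>c\<close> and the pointwise limit below all hold at
    the endpoint too.\<close>
  define g where "g y = h y / (cis (2 * pi * y) - 1)" for y
  define C where "C m = (\<integral>y. indicator {0..<1} y *\<^sub>R (g y * cis (- (2 * pi * of_int m * y))) \<partial>lborel)" for m :: int
  have [measurable]: "(\<lambda>y. cis (a * y)) \<in> borel_measurable borel" for a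
    by (intro borel_measurable_continuous_onI continuous_intros)
  have [measurable]: "g \<in> borel_measurable borel" unfolding g_def by measurable
  have wne: "cis (2 * pi * y) \<noteq> 1" if "0 < y" "y < 1" for y
  proof -
    have "pi * min y (1 - y) > 0" using that by simp
    also have "\<dots> \<le> norm (cis (2 * pi * y) - 1)" using that by (intro norm_cis_minus_1_ge) auto
    finally show ?thesis by auto
  qed
  have L: "L \<ge> 0" using norm_ge_zero[of "h (1/2)"] bound[of "1/2"] by linarith
  have gb: "norm (g y) \<le> L" if "0 \<le> y" "y < 1" for y
  proof (cases "y = 0")
    case False
    have m: "min y (1 - y) > 0" using that False by auto
    have "min y (1 - y) * 1 \<le> min y (1 - y) * pi" using m pi_ge_two by (intro mult_left_mono) auto
    hence "norm (cis (2 * pi * y) - 1) \<ge> min y (1 - y)"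
      using norm_cis_minus_1_ge[of y] that by (simp add: mult.commute)
    hence "L * min y (1 - y) \<le> L * norm (cis (2 * pi * y) - 1)" using L by (intro mult_left_mono)
    hence "norm (h y) \<le> L * norm (cis (2 * pi * y) - 1)" using bound[of y] that by simp
    thus ?thesis using wne[of y] False that by (simp add: g_def norm_divide field_simps)
  qed (use L in \<open>simp add: g_def\<close>)
  have int: "integrable lborel (\<lambda>y. indicator {0..<1} y *\<^sub>R (g y * u y))"
    if [measurable]: "u \<in> borel_measurable borel" and "\<And>y. norm (u y) \<le> B" for u B
  proof (rule Bochner_Integration.integrable_bound)
    show "integrable lborel (\<lambda>y::real. indicator {0..<1} y *\<^sub>R (L * B))"
      by (intro integrable_scaleR_left) auto
    have "norm (g y * u y) \<le> L * B" if "0 \<le> y" "y < 1" for y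
      unfolding norm_mult using gb[OF that] \<open>\<And>y. norm (u y) \<le> B\<close>[of y] L by (intro mult_mono) auto
    thus "AE x in lborel. norm (indicator {0..<1} x *\<^sub>R (g x * u x)) \<le> norm (indicator {0..<1} x *\<^sub>R (L * B))"
      by (auto simp: indicator_def intro!: AE_I2 order_trans[OF _ abs_ge_self])
  qed measurable
  have cis_meas: "(\<lambda>y. cis (- (2 * pi * of_int m * y))) \<in> borel_measurable borel" for m :: int
    by (intro borel_measurable_continuous_onI continuous_intros)
  \<comment> \<open>Multiplication by cis(2 pi y) lowers the frequency from m to m - 1, and h is g
    times (cis(2 pi y) - 1).\<close>
  have cC: "c m = C (m - 1) - C m" for m
  proof -
    have "h y * cis (- (2 * pi * of_int m * y)) =
        g y * cis (- (2 * pi * of_int (m - 1) * y)) - g y * cis (- (2 * pi * of_int m * y))"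
      if "0 \<le> y" "y < 1" for y
    proof (cases "y = 0")
      case True
      have "h 0 = 0" using bound[of 0] by simp
      thus ?thesis using True by (simp add: g_def)
    next
      case False
      have h: "h y = g y * (cis (2 * pi * y) - 1)" using wne[of y] False that by (simp add: g_def)
      have cm: "cis (- (2 * pi * of_int (m - 1) * y)) = cis (2 * pi * y) * cis (- (2 * pi * of_int m * y))"
        by (simp add: cis_mult algebra_simps)
      show ?thesis unfolding h cm by algebra
    qed
    hence "c m = (\<integral>y. indicator {0..<1} y *\<^sub>R (g y * cis (- (2 * pi * of_int (m - 1) * y)))
        - indicator {0..<1} y *\<^sub>R (g y * cis (- (2 * pi * of_int m * y))) \<partial>lborel)"
      unfolding c_def by (intro Bochner_Integration.integral_cong refl) (auto simp: indicator_def)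
    also have "\<dots> = C (m - 1) - C m" unfolding C_def
      by (intro Bochner_Integration.integral_diff int[where B = 1] cis_meas) simp_all
    finally show ?thesis .
  qed
  define w where "w y = cis (2 * pi * y)" for y
  have [measurable]: "w \<in> borel_measurable borel" unfolding w_def by measurable
  have [measurable]: "(\<lambda>y. cnj (w y)) \<in> borel_measurable borel"
    unfolding w_def by (intro borel_measurable_continuous_onI continuous_intros)
  have nw: "norm (w y) = 1" for y by (simp add: w_def)
  \<comment> \<open>Starting at \<open>Suc N\<close> makes the two surviving frequencies -(N+2) and
    N, so both exponentials are natural powers of \<open>w y\<close> or of its conjugate and their
    averages are geometric.\<close>
  define D where "D N = (\<Sum>m\<in>{- int (Suc N)..<int (Suc N)}. c m)" for N
  have D: "D N = (\<integral>y. indicator {0..<1} y *\<^sub>R (g y * (w y ^ (N + 2) - cnj (w y) ^ N)) \<partial>lborel)" for N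
  proof -
    have tele: "(\<Sum>m\<in>{- int K..<int K}. c m) = C (- 1 - int K) - C (int K - 1)" for K
    proof (induction K)
      case (Suc K)
      have "{- int (Suc K)..<int (Suc K)} = insert (- int (Suc K)) (insert (int K) {- int K..<int K})" by auto
      thus ?case using Suc by (simp add: cC algebra_simps)
    qed simp
    have "D N = C (- int (N + 2)) - C (int N)" unfolding D_def tele by (simp add: algebra_simps)
    moreover have "cis (- (2 * pi * of_int (- int (N + 2)) * y)) = w y ^ (N + 2)" for y
      unfolding w_def Complex.DeMoivre by (simp add: algebra_simps)
    moreover have "cis (- (2 * pi * of_int (int N) * y)) = cnj (w y) ^ N" for y
      unfolding w_def cis_cnj Complex.DeMoivre by (simp add: algebra_simps)
    ultimately have "D N = (\<integral>y. indicator {0..<1} y *\<^sub>R (g y * w y ^ (N + 2)) \<partial>lborel) -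
        (\<integral>y. indicator {0..<1} y *\<^sub>R (g y * cnj (w y) ^ N) \<partial>lborel)"
      by (simp add: C_def)
    also have "\<dots> = (\<integral>y. indicator {0..<1} y *\<^sub>R (g y * w y ^ (N + 2)) -
        indicator {0..<1} y *\<^sub>R (g y * cnj (w y) ^ N) \<partial>lborel)"
      by (intro Bochner_Integration.integral_diff[symmetric] int[where B = 1]) (simp_all add: norm_power norm_mult nw)
    finally show ?thesis by (simp add: algebra_simps)
  qed
  define W where "W M y = (\<Sum>N<M. w y ^ (N + 2) - cnj (w y) ^ N) /\<^sub>R real M" for M y
  have [measurable]: "W M \<in> borel_measurable borel" for M unfolding W_def by measurable
  have nW1: "norm (w y ^ (N + 2) - cnj (w y) ^ N) \<le> 2" for y N
    by (rule order_trans[OF norm_triangle_ineq4]) (simp add: norm_power norm_mult nw)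
  have nW: "norm (W M y) \<le> 2" for M y
  proof (cases "M = 0")
    case False
    have "norm (\<Sum>N<M. w y ^ (N + 2) - cnj (w y) ^ N) \<le> (\<Sum>N<M. 2)"
      using nW1 by (intro sum_norm_le) auto
    thus ?thesis using False by (simp add: W_def field_simps)
  qed (simp add: W_def)
  have meanD: "(\<Sum>N<M. D N) /\<^sub>R real M = (\<integral>y. indicator {0..<1} y *\<^sub>R (g y * W M y) \<partial>lborel)" for M
  proof -
    have "(\<Sum>N<M. D N) = (\<integral>y. (\<Sum>N<M. indicator {0..<1} y *\<^sub>R (g y * (w y ^ (N + 2) - cnj (w y) ^ N))) \<partial>lborel)"
      unfolding D using nW1 by (intro Bochner_Integration.integral_sum[symmetric] int[where B = 2]) auto
    also have "\<dots> /\<^sub>R real M = (\<integral>y. (\<Sum>N<M. indicator {0..<1} y *\<^sub>R (g y * (w y ^ (N + 2) - cnj (w y) ^ N))) /\<^sub>R real M \<partial>lborel)"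
      by simp
    also have "(\<lambda>y. (\<Sum>N<M. indicator {0..<1} y *\<^sub>R (g y * (w y ^ (N + 2) - cnj (w y) ^ N))) /\<^sub>R real M) =
        (\<lambda>y. indicator {0..<1} y *\<^sub>R (g y * W M y))"
      by (intro ext) (simp only: W_def scaleR_sum_right[symmetric] sum_distrib_left[symmetric]
          mult_scaleR_right scaleR_left_commute)
    finally show ?thesis .
  qed
  have "(\<lambda>M. \<integral>y. indicator {0..<1} y *\<^sub>R (g y * W M y) \<partial>lborel) \<longlonglongrightarrow> (\<integral>y. (0::complex) \<partial>(lborel :: real measure))"
  proof (rule integral_dominated_convergence[where w = "\<lambda>y. indicator {0..<1} y *\<^sub>R (L * 2)"])
    show "integrable lborel (\<lambda>y::real. indicator {0..<1} y *\<^sub>R (L * 2))"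
      by (intro integrable_scaleR_left) auto
    show "AE y in lborel. norm (indicator {0..<1} y *\<^sub>R (g y * W M y)) \<le> indicator {0..<1} y *\<^sub>R (L * 2)" for M
    proof (rule AE_I2)
      fix y
      have "norm (g y * W M y) \<le> L * 2" if "0 \<le> y" "y < 1"
        unfolding norm_mult using gb[OF that] nW[of M y] L by (intro mult_mono) auto
      thus "norm (indicator {0..<1} y *\<^sub>R (g y * W M y)) \<le> indicator {0..<1} y *\<^sub>R (L * 2)"
        by (auto simp: indicator_def)
    qed
    show "AE y in lborel. (\<lambda>M. indicator {0..<1} y *\<^sub>R (g y * W M y)) \<longlonglongrightarrow> 0"
    proof (rule AE_I2)
      fix y :: real
      consider "y \<notin> {0..<1}" | "y = 0" | "0 < y" "y < 1" by force
      thus "(\<lambda>M. indicator {0..<1} y *\<^sub>R (g y * W M y)) \<longlonglongrightarrow> 0"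
      proof cases
        case 3
        have "w y \<noteq> 1" using wne 3 by (simp add: w_def)
        hence w: "norm (w y) = 1" "w y \<noteq> 1" "norm (cnj (w y)) = 1" "cnj (w y) \<noteq> 1"
          using nw by (simp_all add: complex_cnj_one_iff)
        have "(\<lambda>M. (w y)\<^sup>2 * ((\<Sum>n<M. w y ^ n) /\<^sub>R real M) - (\<Sum>n<M. cnj (w y) ^ n) /\<^sub>R real M) \<longlonglongrightarrow> (w y)\<^sup>2 * 0 - 0"
          by (intro tendsto_intros tendsto_mean_unit_powers w)
        moreover have "(\<lambda>M. (w y)\<^sup>2 * ((\<Sum>n<M. w y ^ n) /\<^sub>R real M) - (\<Sum>n<M. cnj (w y) ^ n) /\<^sub>R real M) = (\<lambda>M. W M y)"
          unfolding W_def sum_subtractf power_add sum_distrib_right[symmetric] scaleR_diff_right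
          by (simp add: mult.commute)
        ultimately have "(\<lambda>M. W M y) \<longlonglongrightarrow> 0" by simp
        hence "(\<lambda>M. indicator {0..<1} y *\<^sub>R (g y * W M y)) \<longlonglongrightarrow> indicator {0..<1} y *\<^sub>R (g y * 0)"
          by (intro tendsto_intros)
        thus ?thesis by simp
      qed (auto simp: g_def)
    qed
  qed measurable
  hence "(\<lambda>M. (\<Sum>N<M. D N) /\<^sub>R real M) \<longlonglongrightarrow> 0" by (simp add: meanD)
  moreover have "D \<longlonglongrightarrow> S" unfolding D_def by (rule LIMSEQ_Suc[OF lim])
  ultimately show "S = 0" using LIMSEQ_Cesaro LIMSEQ_unique by blast
qed

section \<open>The periodised Gaussian and its Fourier series\<close>

definition gauss_sum :: "real \<Rightarrow> real \<Rightarrow> real" where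
  "gauss_sum t x = (\<Sum>\<^sub>\<infinity>k::int. exp (- pi * t * (x + of_int k)\<^sup>2))"

lemma summable_on_gauss:
  fixes c x :: real
  assumes "c > 0"
  shows "(\<lambda>k::int. exp (- c * (x + of_int k)\<^sup>2)) summable_on UNIV"
proof -
  have "(\<lambda>k::int. exp (- c * x\<^sup>2) * exp (- c * of_int k ^ 2 + (- 2 * c * x) * of_int k)) summable_on UNIV"
    by (intro summable_on_cmult_right summable_on_exp_quadratic assms)
  moreover have "exp (- c * x\<^sup>2) * exp (- c * of_int k ^ 2 + (- 2 * c * x) * of_int k) =
      exp (- c * (x + of_int k)\<^sup>2)" for k :: int
    by (simp add: power2_eq_square algebra_simps flip: exp_add)
  ultimately show ?thesis by simp
qed

lemma gauss_sum_summable: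
  assumes "t > 0"
  shows "(\<lambda>k::int. exp (- pi * t * (x + of_int k)\<^sup>2)) summable_on UNIV"
  using summable_on_gauss[of "pi * t" x] assms by simp

lemma gauss_sum_add_1: "gauss_sum t (x + 1) = gauss_sum t x"
  unfolding gauss_sum_def
  by (rule infsum_reindex_bij_witness[of _ "\<lambda>k. k - 1" "\<lambda>k. k + 1"]) (auto simp: algebra_simps)

lemma gauss_sum_LIMSEQ:
  assumes "t > 0"
  shows "(\<lambda>N. \<Sum>k\<in>{- int N..<int N}. exp (- pi * t * (x + of_int k)\<^sup>2)) \<longlonglongrightarrow> gauss_sum t x"
  unfolding gauss_sum_def
  by (intro has_sum_int_LIMSEQ has_sum_infsum gauss_sum_summable assms)

lemma borel_measurable_gauss_sum [measurable]:
  assumes "t > 0"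
  shows "gauss_sum t \<in> borel_measurable borel"
  by (rule borel_measurable_LIMSEQ_metric[OF _ gauss_sum_LIMSEQ[OF assms]]) measurable

lemma sum_le_gauss_sum:
  assumes "t > 0" "finite A"
  shows "(\<Sum>k\<in>A. exp (- pi * t * (x + of_int k)\<^sup>2)) \<le> gauss_sum t x"
  unfolding gauss_sum_def by (rule finite_sum_le_infsum[OF gauss_sum_summable]) (use assms in auto)

text \<open>Mean value estimate whose constant must remain summable over the translates a = x + k.
  Half of the Gaussian exponent, \<open>v\<close>, absorbs the linear factor of the derivative; the
  other half still decays in a, because (a+z)^2 >= a^2/2 - 1 for z in [0, 1].\<close>

lemma exp_gauss_lipschitz:
  fixes t a :: real
  assumes "t > 0" "0 \<le> y" "y \<le> 1" "0 \<le> y'" "y' \<le> 1"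
  shows "\<bar>exp (- pi * t * (a + y)\<^sup>2) - exp (- pi * t * (a + y')\<^sup>2)\<bar>
      \<le> (pi * t + 2) * exp (pi * t / 2) * exp (- (pi * t / 4) * a\<^sup>2) * \<bar>y - y'\<bar>"
proof -
  let ?B = "(pi * t + 2) * exp (pi * t / 2) * exp (- (pi * t / 4) * a\<^sup>2)"
  have "norm (exp (- pi * t * (a + y)\<^sup>2) - exp (- pi * t * (a + y')\<^sup>2)) \<le> ?B * norm (y - y')"
  proof (rule field_differentiable_bound)
    show "convex {0..1::real}" by simp
    show "y \<in> {0..1}" "y' \<in> {0..1}" using assms by auto
    fix z :: real assume z: "z \<in> {0..1}"
    show "((\<lambda>y. exp (- pi * t * (a + y)\<^sup>2)) has_field_derivative
        exp (- pi * t * (a + z)\<^sup>2) * (- pi * t * (2 * (a + z)))) (at z within {0..1})"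
      by (auto intro!: derivative_eq_intros)
    define s where "s = a + z"
    define v where "v = pi * t / 2 * s\<^sup>2"
    have pt: "pi * t > 0" using assms by simp
    have v0: "v \<ge> 0" unfolding v_def using pt by simp
    have "0 \<le> (\<bar>s\<bar> - 1)\<^sup>2" by simp
    hence "2 * \<bar>s\<bar> \<le> 1 + s\<^sup>2" by (simp add: power2_eq_square algebra_simps)
    hence "pi * t * (2 * \<bar>s\<bar>) \<le> pi * t * (1 + s\<^sup>2)" using pt by (intro mult_left_mono) auto
    also have "\<dots> = pi * t + 2 * v" by (simp add: v_def algebra_simps)
    also have "\<dots> \<le> (pi * t + 2) * (1 + v)"
      using mult_nonneg_nonneg[OF less_imp_le[OF pt] v0] by (simp add: algebra_simps)
    also have "\<dots> \<le> (pi * t + 2) * exp v" using pt by (intro mult_left_mono exp_ge_add_one_self) auto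
    finally have 1: "pi * t * (2 * \<bar>s\<bar>) \<le> (pi * t + 2) * exp v" .
    have "z\<^sup>2 \<le> 1" using z by (simp add: power_le_one)
    \<comment> \<open>Twice this square is the slack in (a+z)^2 >= a^2/2 - z^2.\<close>
    moreover have "0 \<le> (a / 2 + z)\<^sup>2 * 2" by simp
    ultimately have "s\<^sup>2 \<ge> a\<^sup>2 / 2 - 1"
      by (simp add: s_def power2_eq_square algebra_simps)
    hence "pi * t / 2 * s\<^sup>2 \<ge> pi * t / 2 * (a\<^sup>2 / 2 - 1)" using pt by (intro mult_left_mono) auto
    hence 2: "- v \<le> pi * t / 2 + - (pi * t / 4) * a\<^sup>2" by (simp add: v_def algebra_simps)
    have "norm (exp (- pi * t * s\<^sup>2) * (- pi * t * (2 * s))) = exp (- pi * t * s\<^sup>2) * (pi * t * (2 * \<bar>s\<bar>))"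
      using assms by (simp add: abs_mult)
    also have "\<dots> \<le> exp (- pi * t * s\<^sup>2) * ((pi * t + 2) * exp v)"
      using 1 by (intro mult_left_mono) auto
    also have "\<dots> = (pi * t + 2) * exp (- v)"
      by (simp add: v_def mult_exp_exp mult.left_commute)
    also have "\<dots> \<le> (pi * t + 2) * exp (pi * t / 2 + - (pi * t / 4) * a\<^sup>2)"
      using pt 2 by (intro mult_left_mono) auto
    also have "\<dots> = ?B" by (simp only: exp_add mult.assoc)
    finally show "norm (exp (- pi * t * (a + z)\<^sup>2) * (- pi * t * (2 * (a + z)))) \<le> ?B" by (simp only: s_def)
  qed
  thus ?thesis by (simp only: real_norm_def)
qed

text \<open>Summation of \<open>exp_gauss_lipschitz\<close> over all translates. This is the
  regularity that Chernoff's argument consumes; it also bounds the periodised Gaussian on one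
  period, as dominated convergence demands.\<close>

lemma gauss_sum_lipschitz:
  assumes "t > 0"
  obtains L where "L \<ge> 0"
    "\<And>y y'. 0 \<le> y \<Longrightarrow> y \<le> 1 \<Longrightarrow> 0 \<le> y' \<Longrightarrow> y' \<le> 1 \<Longrightarrow>
      \<bar>gauss_sum t (x + y) - gauss_sum t (x + y')\<bar> \<le> L * \<bar>y - y'\<bar>"
proof
  define K where "K = (pi * t + 2) * exp (pi * t / 2)"
  define L where "L = (\<Sum>\<^sub>\<infinity>k::int. K * exp (- (pi * t / 4) * (x + of_int k)\<^sup>2))"
  have K: "K \<ge> 0" using assms by (simp add: K_def)
  have summ: "(\<lambda>k::int. K * exp (- (pi * t / 4) * (x + of_int k)\<^sup>2)) summable_on UNIV"
    using assms by (intro summable_on_cmult_right summable_on_gauss) auto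
  show "L \<ge> 0" unfolding L_def using K by (intro infsum_nonneg) auto
  fix y y' :: real assume y: "0 \<le> y" "y \<le> 1" "0 \<le> y'" "y' \<le> 1"
  have "((\<lambda>k::int. exp (- pi * t * (x + y + of_int k)\<^sup>2) - exp (- pi * t * (x + y' + of_int k)\<^sup>2))
      has_sum (gauss_sum t (x + y) - gauss_sum t (x + y'))) UNIV"
    unfolding gauss_sum_def diff_conv_add_uminus
    by (intro has_sum_add has_sum_uminusI has_sum_infsum gauss_sum_summable assms)
  moreover have "((\<lambda>k::int. K * exp (- (pi * t / 4) * (x + of_int k)\<^sup>2) * \<bar>y - y'\<bar>) has_sum L * \<bar>y - y'\<bar>) UNIV"
    unfolding L_def by (intro has_sum_cmult_left has_sum_infsum summ)
  moreover have "norm (exp (- pi * t * (x + y + of_int k)\<^sup>2) - exp (- pi * t * (x + y' + of_int k)\<^sup>2))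
      \<le> K * exp (- (pi * t / 4) * (x + of_int k)\<^sup>2) * \<bar>y - y'\<bar>" for k :: int
    using exp_gauss_lipschitz[OF assms y, of "x + of_int k"] by (simp add: K_def add_ac)
  ultimately have "norm (gauss_sum t (x + y) - gauss_sum t (x + y')) \<le> L * \<bar>y - y'\<bar>"
    by (rule norm_infsum_le)
  thus "\<bar>gauss_sum t (x + y) - gauss_sum t (x + y')\<bar> \<le> L * \<bar>y - y'\<bar>" by simp
qed

lemma integrable_gauss:
  assumes "t > 0"
  shows "integrable lborel (\<lambda>y. exp (- pi * t * (x + y)\<^sup>2))"
proof -
  have s: "sqrt (2 * pi * t) > 0" using assms by simp
  have "integrable lborel std_normal_density" by (rule integrable_normal_density) simp
  from lborel_integrable_real_affine[OF this, of "sqrt (2 * pi * t)" "sqrt (2 * pi * t) * x"] s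
  have "integrable lborel (\<lambda>y. sqrt (2 * pi) * std_normal_density (sqrt (2 * pi * t) * x + sqrt (2 * pi * t) * y))"
    by (intro integrable_mult_right) (simp only: order_less_irrefl not_False_eq_True simp_thms; blast)
  moreover have "sqrt (2 * pi) * std_normal_density (sqrt (2 * pi * t) * x + sqrt (2 * pi * t) * y) = exp (- pi * t * (x + y)\<^sup>2)" for y
    using assms by (simp add: std_normal_density_def power_mult_distrib flip: distrib_left)
  ultimately show ?thesis by simp
qed

lemma gauss_fourier_transform:
  fixes m :: real
  assumes "t > 0"
  shows "(\<integral>y. of_real (exp (- pi * t * y\<^sup>2)) * cis (- (2 * pi * m * y)) \<partial>lborel) = of_real (exp (- pi * m\<^sup>2 / t) / sqrt t)"
proof -
  \<comment> \<open>The scale \<open>c\<close> turns the standard normal density at c*y into a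
    multiple of exp(-pi t y^2), and \<open>s\<close> is chosen so that s*c*y = -2 pi m y. The
    transform is then read off from the characteristic function exp(-s^2/2).\<close>
  define c where "c = sqrt (2 * pi * t)"
  define s where "s = - 2 * pi * m / c"
  have c: "c > 0" "c\<^sup>2 = 2 * pi * t" using assms by (simp_all add: c_def)
  have "char std_normal_distribution s = (\<integral>x. std_normal_density x *\<^sub>R iexp (s * x) \<partial>lborel)"
    unfolding char_def by (subst integral_density) auto
  also have "\<dots> = c *\<^sub>R (\<integral>y. std_normal_density (0 + c * y) *\<^sub>R iexp (s * (0 + c * y)) \<partial>lborel)"
    using c by (subst lborel_integral_real_affine[of c _ 0]) auto
  also have "(\<lambda>y. std_normal_density (0 + c * y) *\<^sub>R iexp (s * (0 + c * y))) =
      (\<lambda>y. (1 / sqrt (2 * pi)) *\<^sub>R (of_real (exp (- pi * t * y\<^sup>2)) * cis (- (2 * pi * m * y))))"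
  proof
    fix y
    have "s * (0 + c * y) = - (2 * pi * m * y)" using c by (simp add: s_def)
    hence "iexp (s * (0 + c * y)) = cis (- (2 * pi * m * y))" by (simp only: cis_conv_exp)
    moreover have "std_normal_density (0 + c * y) = (1 / sqrt (2 * pi)) * exp (- pi * t * y\<^sup>2)"
      using c by (simp add: std_normal_density_def power_mult_distrib)
    ultimately show "std_normal_density (0 + c * y) *\<^sub>R iexp (s * (0 + c * y)) =
        (1 / sqrt (2 * pi)) *\<^sub>R (of_real (exp (- pi * t * y\<^sup>2)) * cis (- (2 * pi * m * y)))"
      by (simp add: scaleR_conv_of_real)
  qed
  also have "c *\<^sub>R (\<integral>y. (1 / sqrt (2 * pi)) *\<^sub>R (of_real (exp (- pi * t * y\<^sup>2)) * cis (- (2 * pi * m * y))) \<partial>lborel) =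
     (c / sqrt (2 * pi)) *\<^sub>R (\<integral>y. (of_real (exp (- pi * t * y\<^sup>2)) * cis (- (2 * pi * m * y))) \<partial>lborel)"
    by simp
  also have "c / sqrt (2 * pi) = sqrt t" using assms by (simp add: c_def real_sqrt_mult)
  finally have "char std_normal_distribution s = sqrt t *\<^sub>R
      (\<integral>y. of_real (exp (- pi * t * y\<^sup>2)) * cis (- (2 * pi * m * y)) \<partial>lborel)" .
  moreover have "char std_normal_distribution s = of_real (exp (- s\<^sup>2 / 2))"
    by (simp add: char_std_normal_distribution)
  moreover have "s\<^sup>2 / 2 = pi * m\<^sup>2 / t"
    using assms unfolding s_def power_divide c by (simp add: power2_eq_square field_simps)
  ultimately show ?thesis
    using assms by (simp add: scaleR_conv_of_real field_simps)
qed

lemma gauss_fourier_transform_shift: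
  assumes "t > 0"
  shows "(\<integral>y. of_real (exp (- pi * t * (x + y)\<^sup>2)) * cis (- (2 * pi * m * y)) \<partial>lborel) =
    cis (2 * pi * m * x) * of_real (exp (- pi * m\<^sup>2 / t) / sqrt t)"
proof -
  have "(\<integral>y. of_real (exp (- pi * t * (x + y)\<^sup>2)) * cis (- (2 * pi * m * y)) \<partial>lborel) =
    (\<integral>y. of_real (exp (- pi * t * y\<^sup>2)) * cis (- (2 * pi * m * (y - x))) \<partial>lborel)"
    by (subst (2) lborel_integral_real_affine[of 1 _ x]) auto
  also have "(\<lambda>y. of_real (exp (- pi * t * y\<^sup>2)) * cis (- (2 * pi * m * (y - x)))) =
     (\<lambda>y. cis (2 * pi * m * x) * (of_real (exp (- pi * t * y\<^sup>2)) * cis (- (2 * pi * m * y))))"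
    by (simp add: mult.left_commute[of "cis (2 * pi * m * x)"] cis_mult right_diff_distrib)
  finally show ?thesis
    by (simp only: integral_mult_right_zero gauss_fourier_transform[OF assms])
qed

lemma fourier_coefficient_one:
  "(\<integral>y. indicator {0..<1} y *\<^sub>R cis (- (2 * pi * of_int m * y)) \<partial>lborel) = (if m = 0 then 1 else 0)"
proof (cases "m = 0")
  case True
  have "(\<integral>y. indicator {0..<1::real} y *\<^sub>R (1::complex) \<partial>lborel) = 1"
  proof (rule has_bochner_integral_integral_eq)
    have "has_bochner_integral lborel (indicator {0..<1::real}) (measure lborel {0..<1::real})"
      by (rule has_bochner_integral_real_indicator) simp_all
    moreover have "measure lborel {0..<1::real} = 1" by (rule trans[OF measure_lborel_Ico]) simp_all
    ultimately have "has_bochner_integral lborel (indicator {0..<1::real}) (1 :: real)" by (simp only:)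
    from has_bochner_integral_scaleR_left[OF this, of "1 :: complex"]
    show "has_bochner_integral lborel (\<lambda>y::real. indicator {0..<1} y *\<^sub>R (1::complex)) 1" by simp
  qed
  thus ?thesis using True by simp
next
  case False
  define a where "a = 2 * pi * of_int m"
  have a: "a \<noteq> 0" using False by (simp add: a_def)
  define F where "F y = cis (- (a * y)) * (\<i> / of_real a)" for y
  have ai: "cis (- a) = 1" using cis_multiple_2pi[of "- of_int m"] by (simp add: a_def mult_ac)
  have [measurable]: "(\<lambda>y. cis (- (a * y))) \<in> borel_measurable borel"
    by (intro borel_measurable_continuous_onI continuous_intros)
  have "(\<integral>y. indicator {0..<1} y *\<^sub>R cis (- (a * y)) \<partial>lborel) = (\<integral>y. indicator {0..1} y *\<^sub>R cis (- (a * y)) \<partial>lborel)"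
  proof (rule integral_cong_AE)
    show "AE y in lborel. indicator {0..<1} y *\<^sub>R cis (- (a * y)) = indicator {0..1} y *\<^sub>R cis (- (a * y))"
      using AE_lborel_singleton[of "1::real"] by eventually_elim (auto simp: indicator_def)
  qed measurable
  also have "\<dots> = F 1 - F 0"
  proof (rule has_bochner_integral_integral_eq, rule has_bochner_integral_FTC_Icc)
    show "(F has_vector_derivative cis (- (a * y))) (at y within {0..1})" for y
    proof -
      have "((\<lambda>w. exp (- (\<i> * of_real a * w)) * (\<i> / of_real a)) has_field_derivative
          exp (- (\<i> * of_real a * of_real y))) (at (of_real y))"
        using a by (auto intro!: derivative_eq_intros)
      from has_vector_derivative_real_field[OF this, of "{0..1}"] show ?thesis
        by (simp add: F_def [abs_def] cis_conv_exp mult.assoc)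
    qed
  qed (auto intro!: continuous_intros)
  also have "\<dots> = 0" using ai by (simp add: F_def)
  finally show ?thesis using False by (simp add: a_def)
qed

text \<open>The character cis(-2 pi m y) has period 1, so it can be multiplied into every translate.
  Unfolding then turns the coefficient of the periodisation into the Fourier transform of a single
  shifted Gaussian.\<close>

lemma gauss_sum_fourier_coefficient:
  fixes m :: int
  assumes t: "t > 0"
  shows "(\<integral>y. indicator {0..<1} y *\<^sub>R (of_real (gauss_sum t (x + y)) * cis (- (2 * pi * of_int m * y))) \<partial>lborel) =
    cis (2 * pi * of_int m * x) * of_real (exp (- pi * (of_int m)\<^sup>2 / t) / sqrt t)"
proof -
  note [measurable] = borel_measurable_gauss_sum[OF t]
  obtain L where L: "L \<ge> 0" "\<And>y y'. 0 \<le> y \<Longrightarrow> y \<le> 1 \<Longrightarrow> 0 \<le> y' \<Longrightarrow> y' \<le> 1 \<Longrightarrow>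
      \<bar>gauss_sum t (x + y) - gauss_sum t (x + y')\<bar> \<le> L * \<bar>y - y'\<bar>"
    using gauss_sum_lipschitz[OF t] by metis
  define f where "f y = of_real (exp (- pi * t * (x + y)\<^sup>2)) * cis (- (2 * pi * of_int m * y))" for y
  have [measurable]: "(\<lambda>y. cis (- (2 * pi * of_int m * y))) \<in> borel_measurable borel"
    by (intro borel_measurable_continuous_onI continuous_intros)
  have [measurable]: "f \<in> borel_measurable borel"
    unfolding f_def by measurable
  have fk: "f (y + of_int k) = of_real (exp (- pi * t * (x + y + of_int k)\<^sup>2)) * cis (- (2 * pi * of_int m * y))" for y k
  proof -
    have "cis (- (2 * pi * of_int m * (y + of_int k))) = cis (- (2 * pi * of_int m * y)) * cis (2 * pi * of_int (- (m * k)))"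
      by (simp add: cis_mult algebra_simps)
    also have "cis (2 * pi * of_int (- (m * k))) = 1" by (rule cis_multiple_2pi) auto
    finally show ?thesis by (simp add: f_def add_ac)
  qed
  have "(\<integral>y. indicator {0..<1} y *\<^sub>R (of_real (gauss_sum t (x + y)) * cis (- (2 * pi * of_int m * y))) \<partial>lborel) = (\<integral>y. f y \<partial>lborel)"
  proof (rule integral_periodization[where C = "gauss_sum t x + L"])
    show "integrable lborel f"
    proof (rule Bochner_Integration.integrable_bound[OF integrable_gauss[OF t, of x]])
      show "AE y in lborel. norm (f y) \<le> norm (exp (- pi * t * (x + y)\<^sup>2))"
        by (rule AE_I2) (simp add: f_def norm_mult)
    qed measurable
    show "(\<lambda>N. \<Sum>k\<in>{- int N..<int N}. f (y + of_int k)) \<longlonglongrightarrow>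
        of_real (gauss_sum t (x + y)) * cis (- (2 * pi * of_int m * y))" for y
      unfolding fk sum_distrib_right[symmetric] of_real_sum[symmetric]
      by (intro tendsto_intros gauss_sum_LIMSEQ t)
    show "norm (\<Sum>k\<in>{- int N..<int N}. f (y + of_int k)) \<le> gauss_sum t x + L" if "y \<in> {0..<1}" for y N
    proof -
      have "norm (\<Sum>k\<in>{- int N..<int N}. f (y + of_int k)) = (\<Sum>k\<in>{- int N..<int N}. exp (- pi * t * (x + y + of_int k)\<^sup>2))"
        unfolding fk sum_distrib_right[symmetric] of_real_sum[symmetric]
        by (simp add: norm_mult sum_nonneg del: of_real_sum)
      also have "\<dots> \<le> gauss_sum t (x + y)" by (rule sum_le_gauss_sum[OF t]) auto
      also have "\<dots> \<le> gauss_sum t x + L * \<bar>y\<bar>" using L(2)[of y 0] that by auto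
      also have "L * \<bar>y\<bar> \<le> L" using L(1) that by (intro mult_left_le) auto
      finally show ?thesis by simp
    qed
  qed measurable
  thus ?thesis by (simp only: f_def gauss_fourier_transform_shift[OF t])
qed

text \<open>Poisson summation at the single point x. Subtracting the value at x gives a function
  \<open>h\<close> that vanishes at both ends of the period, by periodicity, and is Lipschitz there.
  By Chernoff's argument its Fourier series sums to 0 at the origin, where the known coefficients
  are absolutely summable; taking real parts yields the cosines.\<close>

theorem gauss_sum_transformation:
  assumes t: "t > 0"
  shows "((\<lambda>m::int. exp (- pi * (of_int m)\<^sup>2 / t) * cos (2 * pi * of_int m * x)) has_sum (sqrt t * gauss_sum t x)) UNIV"
proof -
  note [measurable] = borel_measurable_gauss_sum[OF t]
  obtain L where L: "L \<ge> 0" "\<And>y y'. 0 \<le> y \<Longrightarrow> y \<le> 1 \<Longrightarrow> 0 \<le> y' \<Longrightarrow> y' \<le> 1 \<Longrightarrow>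
      \<bar>gauss_sum t (x + y) - gauss_sum t (x + y')\<bar> \<le> L * \<bar>y - y'\<bar>"
    using gauss_sum_lipschitz[OF t] by metis
  define a where "a m = cis (2 * pi * of_int m * x) * of_real (exp (- pi * (of_int m)\<^sup>2 / t) / sqrt t)" for m :: int
  have "a summable_on UNIV"
  proof (rule summable_on_bound)
    show "(\<lambda>m::int. exp (- (pi / t) * (0 + of_int m)\<^sup>2) * (1 / sqrt t)) summable_on UNIV"
      using t by (intro summable_on_cmult_left summable_on_gauss) auto
  qed (use t in \<open>simp add: a_def norm_mult norm_divide\<close>)
  hence a: "(a has_sum infsum a UNIV) UNIV" by (rule has_sum_infsum)
  define h where "h y = complex_of_real (gauss_sum t (x + y) - gauss_sum t x)" for y
  define c where "c m = (\<integral>y. indicator {0..<1} y *\<^sub>R (h y * cis (- (2 * pi * of_int m * y))) \<partial>lborel)" for m :: int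
  have c: "c m = a m - (if m = 0 then of_real (gauss_sum t x) else 0)" for m
  proof -
    let ?e = "\<lambda>y. cis (- (2 * pi * of_int m * y))"
    have [measurable]: "?e \<in> borel_measurable borel"
      by (intro borel_measurable_continuous_onI continuous_intros)
    have ie: "integrable lborel (\<lambda>y. indicator {0..<1} y *\<^sub>R ?e y)"
    proof (rule Bochner_Integration.integrable_bound)
      show "integrable lborel (\<lambda>y::real. indicator {0..<1} y *\<^sub>R (1::real))"
        by (intro integrable_scaleR_left) auto
    qed (auto simp: indicator_def)
    have ig: "integrable lborel (\<lambda>y. indicator {0..<1} y *\<^sub>R (of_real (gauss_sum t (x + y)) * ?e y))"
    proof (rule Bochner_Integration.integrable_bound)
      show "integrable lborel (\<lambda>y::real. indicator {0..<1} y *\<^sub>R (\<bar>gauss_sum t x\<bar> + L))"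
        by (intro integrable_scaleR_left) auto
      have "\<bar>gauss_sum t (x + y)\<bar> \<le> \<bar>gauss_sum t x\<bar> + L" if "0 \<le> y" "y < 1" for y
        using L(2)[of y 0] that mult_left_le[OF _ L(1), of y] by auto
      thus "AE y in lborel. norm (indicator {0..<1} y *\<^sub>R (of_real (gauss_sum t (x + y)) * ?e y)) \<le>
          norm (indicator {0..<1} y *\<^sub>R (\<bar>gauss_sum t x\<bar> + L))"
        using L(1) by (intro AE_I2) (auto simp: indicator_def norm_mult)
    qed measurable
    have "c m = (\<integral>y. indicator {0..<1} y *\<^sub>R (of_real (gauss_sum t (x + y)) * ?e y) -
        of_real (gauss_sum t x) * (indicator {0..<1} y *\<^sub>R ?e y) \<partial>lborel)"
      unfolding c_def h_def by (intro Bochner_Integration.integral_cong refl) (simp add: algebra_simps)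
    also have "\<dots> = a m - of_real (gauss_sum t x) * (if m = 0 then 1 else 0)"
      unfolding Bochner_Integration.integral_diff[OF ig integrable_mult_right[OF ie]] integral_mult_right_zero
        gauss_sum_fourier_coefficient[OF t] fourier_coefficient_one a_def ..
    finally show ?thesis by simp
  qed
  have "infsum a UNIV - of_real (gauss_sum t x) = 0"
  proof (rule fourier_partial_sums_at_zero)
    show "h \<in> borel_measurable borel" unfolding h_def by measurable
    show "norm (h y) \<le> L * min y (1 - y)" if "0 \<le> y" "y \<le> 1" for y
    proof -
      have "gauss_sum t (x + 1) = gauss_sum t x" by (rule gauss_sum_add_1)
      hence "\<bar>gauss_sum t (x + y) - gauss_sum t x\<bar> \<le> L * y"
          "\<bar>gauss_sum t (x + y) - gauss_sum t x\<bar> \<le> L * (1 - y)"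
        using L(2)[of y 0] L(2)[of y 1] that by (auto simp: abs_if split: if_splits)
      thus ?thesis unfolding h_def norm_of_real by (simp add: min_def)
    qed
    \<comment> \<open>For N = 0 the half-open interval is empty and would miss the corrected
      coefficient m = 0.\<close>
    have "(\<Sum>m\<in>{- int N..<int N}. c m) = (\<Sum>m\<in>{- int N..<int N}. a m) - of_real (gauss_sum t x)" if "N \<ge> 1" for N
      using that by (simp add: c sum_subtractf)
    hence ev: "\<forall>\<^sub>F N in sequentially. (\<Sum>m\<in>{- int N..<int N}. a m) - of_real (gauss_sum t x) = (\<Sum>m\<in>{- int N..<int N}. c m)"
      by (intro eventually_sequentiallyI[of 1]) simp
    have "(\<lambda>N. (\<Sum>m\<in>{- int N..<int N}. a m) - of_real (gauss_sum t x)) \<longlonglongrightarrow> infsum a UNIV - of_real (gauss_sum t x)"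
      by (intro tendsto_intros has_sum_int_LIMSEQ a)
    hence "(\<lambda>N. \<Sum>m\<in>{- int N..<int N}. c m) \<longlonglongrightarrow> infsum a UNIV - of_real (gauss_sum t x)"
      by (rule Lim_transform_eventually[OF _ ev])
    thus "(\<lambda>N. \<Sum>m\<in>{- int N..<int N}. \<integral>y. indicator {0..<1} y *\<^sub>R (h y * cis (- (2 * pi * of_int m * y))) \<partial>lborel)
        \<longlonglongrightarrow> infsum a UNIV - of_real (gauss_sum t x)" by (simp only: c_def)
  qed
  hence "infsum a UNIV = of_real (gauss_sum t x)" by simp
  with a have "((\<lambda>m. sqrt t * Re (a m)) has_sum sqrt t * gauss_sum t x) UNIV"
    by (intro has_sum_cmult_right) (auto dest: has_sum_Re)
  moreover have "sqrt t * Re (a m) = exp (- pi * (of_int m)\<^sup>2 / t) * cos (2 * pi * of_int m * x)" for m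
    using t by (simp add: a_def)
  ultimately show ?thesis by (simp only:)
qed

lemma infsum_int_even_odd:
  fixes f :: "int \<Rightarrow> real"
  assumes "f summable_on UNIV"
  shows "(\<lambda>j. f (2 * j)) summable_on UNIV" "(\<lambda>j. f (2 * j + 1)) summable_on UNIV"
    "infsum f UNIV = infsum (\<lambda>j. f (2 * j)) UNIV + infsum (\<lambda>j. f (2 * j + 1)) UNIV"
proof -
  have "bij_betw (\<lambda>j::int. 2 * j) UNIV {k. even k}"
    by (rule bij_betwI[where g = "\<lambda>k. k div 2"]) auto
  note e = infsum_reindex_bij_betw[OF this, of f] summable_on_reindex_bij_betw[OF this, of f]
  have "bij_betw (\<lambda>j::int. 2 * j + 1) UNIV {k. odd k}"
    by (rule bij_betwI[where g = "\<lambda>k. k div 2"]) auto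
  note o = infsum_reindex_bij_betw[OF this, of f] summable_on_reindex_bij_betw[OF this, of f]
  have s: "f summable_on {k. even k}" "f summable_on {k. odd k}"
    by (auto intro: summable_on_subset_banach[OF assms])
  show "(\<lambda>j. f (2 * j)) summable_on UNIV" "(\<lambda>j. f (2 * j + 1)) summable_on UNIV"
    using e o s by simp_all
  have "infsum f ({k. even k} \<union> {k. odd k}) = infsum f {k. even k} + infsum f {k. odd k}"
    by (rule infsum_Un_disjoint) (use s in auto)
  moreover have "{k. even k} \<union> {k. odd k} = (UNIV :: int set)" by auto
  ultimately show "infsum f UNIV = infsum (\<lambda>j. f (2 * j)) UNIV + infsum (\<lambda>j. f (2 * j + 1)) UNIV"
    using e o by simp
qed

text \<open>The alternating sum is twice its even part minus the full sum, and the even part is a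
  periodised Gaussian with parameters 4t and x/2. After transformation the full sum becomes the
  even-indexed part of the series \<open>b\<close> that belongs to 4t and x/2, so the difference
  retains exactly the odd frequencies.\<close>

theorem alternating_gauss_sum_transformation:
  assumes t: "t > 0"
  shows "sqrt t * (\<Sum>\<^sub>\<infinity>k::int. (-1) powi k * exp (- pi * t * (x + of_int k)\<^sup>2)) =
    (\<Sum>\<^sub>\<infinity>j::int. exp (- pi * (of_int (2 * j + 1))\<^sup>2 / (4 * t)) * cos (pi * of_int (2 * j + 1) * x))"
proof -
  define f where "f k = exp (- pi * t * (x + of_int k)\<^sup>2)" for k :: int
  define b where "b m = exp (- pi * (of_int m)\<^sup>2 / (4 * t)) * cos (pi * of_int m * x)" for m :: int
  have f: "f summable_on UNIV" unfolding f_def using gauss_sum_summable[OF t] by simp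
  have fe: "f (2 * j) = exp (- pi * (4 * t) * (x / 2 + of_int j)\<^sup>2)" for j
    by (simp add: f_def power2_eq_square algebra_simps)
  have "(b has_sum (sqrt (4 * t) * gauss_sum (4 * t) (x / 2))) UNIV"
    using gauss_sum_transformation[of "4 * t" "x / 2"] t by (simp add: b_def [abs_def] mult_ac)
  hence b: "b summable_on UNIV" "infsum b UNIV = 2 * sqrt t * gauss_sum (4 * t) (x / 2)"
    by (auto simp: has_sum_iff real_sqrt_mult)
  have "((\<lambda>j. b (2 * j)) has_sum (sqrt t * gauss_sum t x)) UNIV"
    using gauss_sum_transformation[OF t, of x] t by (simp add: b_def mult_ac power_mult_distrib)
  hence be: "infsum (\<lambda>j. b (2 * j)) UNIV = sqrt t * gauss_sum t x" by (rule infsumI)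
  define F where "F k = (-1) powi k * f k" for k
  have F: "F summable_on UNIV"
    by (rule summable_on_bound[OF f]) (simp add: F_def f_def abs_mult flip: power_int_abs)
  have "infsum F UNIV = infsum (\<lambda>j. f (2 * j)) UNIV + infsum (\<lambda>j. - f (2 * j + 1)) UNIV"
    by (subst infsum_int_even_odd(3)[OF F]) (simp add: F_def power_int_add power_int_mult)
  also have "\<dots> = 2 * infsum (\<lambda>j. f (2 * j)) UNIV - infsum f UNIV"
    using infsum_int_even_odd(3)[OF f] by (simp add: infsum_uminus)
  also have "infsum (\<lambda>j. f (2 * j)) UNIV = gauss_sum (4 * t) (x / 2)" by (simp only: fe gauss_sum_def)
  also have "infsum f UNIV = gauss_sum t x" by (simp only: f_def[abs_def] gauss_sum_def)
  finally have "infsum F UNIV = 2 * gauss_sum (4 * t) (x / 2) - gauss_sum t x" .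
  hence "sqrt t * infsum F UNIV = infsum b UNIV - infsum (\<lambda>j. b (2 * j)) UNIV"
    unfolding b be by (simp only: right_diff_distrib mult_ac)
  also have "\<dots> = infsum (\<lambda>j. b (2 * j + 1)) UNIV"
    using infsum_int_even_odd(3)[OF b(1)] by simp
  finally show ?thesis by (simp only: F_def [abs_def] f_def b_def)
qed

section \<open>Expansion of Ramanujan's function\<close>

lemma theta_term_exp:
  fixes q x :: real
  assumes "0 < q" "0 < x"
  shows "q powi k\<^sup>2 * x powi k = exp (- (- ln q) * of_int k ^ 2 + ln x * of_int k)"
  using assms by (simp add: powr_real_of_int'[symmetric] powr_def exp_add mult.commute)

lemma theta_summable:
  fixes q x :: real
  assumes "0 < q" "q < 1" "0 < x"
  shows "(\<lambda>k::int. q powi k\<^sup>2 * x powi k) summable_on UNIV"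
  unfolding theta_term_exp[OF assms(1,3)] using assms by (intro summable_on_exp_quadratic) simp

text \<open>Reflecting k turns the inverse argument into powers of x itself, the form in which the
  shifted series of Ramanujan's function arises.\<close>

lemma theta3_inverse_has_sum:
  fixes q x :: real
  assumes "0 < q" "q < 1" "0 < x"
  shows "((\<lambda>k::int. q powi k\<^sup>2 * x powi k) has_sum theta3 (inverse x) q) UNIV"
proof -
  have "((\<lambda>k::int. q powi k\<^sup>2 * inverse x powi k) has_sum theta3 (inverse x) q) UNIV"
    using theta_summable[of q "inverse x"] assms by (simp add: theta3_def)
  also have "?this \<longleftrightarrow> ?thesis"
    by (rule has_sum_reindex_bij_witness[of _ uminus uminus]) (auto simp: power_int_minus power_int_inverse)
  finally show ?thesis .
qed

lemma theta4_inverse_has_sum: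
  fixes z :: complex
  assumes "0 < q" "q < 1" "z \<noteq> 0"
  shows "((\<lambda>k::int. of_real (q powi k\<^sup>2) * (- z) powi k) has_sum theta4 (inverse z) q) UNIV"
proof -
  let ?f = "\<lambda>k::int. (- 1) powi k * complex_of_real (q powi k\<^sup>2) * inverse z powi k"
  have "?f summable_on UNIV"
    using theta_summable[of q "cmod (inverse z)"] assms
    by (rule_tac summable_on_bound) (auto simp: norm_mult norm_power_int norm_inverse)
  hence "(?f has_sum theta4 (inverse z) q) UNIV" by (simp add: theta4_def)
  also have "?this \<longleftrightarrow> ?thesis"
  proof (rule has_sum_reindex_bij_witness[of _ uminus uminus])
    fix k :: int
    have "(- z) powi (- k) = (-1) powi k * inverse z powi k"
      unfolding power_int_mult_distrib[symmetric] by (simp add: power_int_minus power_int_inverse[symmetric])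
    thus "of_real (q powi (- k)\<^sup>2) * (- z) powi (- k) = ?f k" by (simp add: mult_ac)
  qed auto
  finally show ?thesis .
qed

text \<open>Rests on k^2 - 2nk = (k-n)^2 - n^2 with j = k - n. The coefficient \<open>d\<close>
  vanishes at negative arguments, so a sum over all integers j is really one over k >= 0. The
  conclusion uses \<open>sums\<close> because convergence is needed again to see that values at real
  arguments are real.\<close>

lemma ramanujan_A_shift:
  fixes z :: complex and q :: real
  defines "d \<equiv> \<lambda>m::int. if m < 0 then 0 else qpoch_inf q q / qpoch q q (nat m)"
  assumes q: "0 < q" "q < 1" and z: "z \<noteq> 0"
    and S: "((\<lambda>j::int. of_real (q powi j\<^sup>2 * d (int n + j)) * (- z) powi j) has_sum S) UNIV"
  shows "(\<lambda>k. of_real (q ^ k\<^sup>2 / qpoch q q k) * (- (of_real (q powi (- 2 * int n)) * z)) ^ k) sums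
    ((- z) ^ n * S / of_real (qpoch_inf q q * q ^ n\<^sup>2))"
proof -
  define a where "a j = of_real (q powi j\<^sup>2 * d (int n + j)) * (- z) powi j" for j
  have "(a has_sum S) {- int n..}"
    using S by (rule has_sum_cong_neutral[THEN iffD1, rotated -1]) (auto simp: a_def d_def)
  also have "?this \<longleftrightarrow> ((\<lambda>k::nat. a (int k - int n)) has_sum S) UNIV"
    by (rule has_sum_reindex_bij_witness[of _ "\<lambda>k. int k - int n" "\<lambda>j. nat (j + int n)"]) auto
  finally have "(\<lambda>k. a (int k - int n)) sums S" by (rule has_sum_imp_sums)
  hence "(\<lambda>k. ((- z) ^ n / of_real (qpoch_inf q q * q ^ n\<^sup>2)) * a (int k - int n)) sums
      (((- z) ^ n / of_real (qpoch_inf q q * q ^ n\<^sup>2)) * S)" by (rule sums_mult)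
  moreover have "((- z) ^ n / of_real (qpoch_inf q q * q ^ n\<^sup>2)) * a (int k - int n) =
      of_real (q ^ k\<^sup>2 / qpoch q q k) * (- (of_real (q powi (- 2 * int n)) * z)) ^ k" for k
  proof -
    have Q: "qpoch_inf q q \<noteq> 0" using qpoch_inf_pos[OF q] by simp
    have "q ^ k\<^sup>2 * (q powi (- 2 * int n)) ^ k = q powi (int (k\<^sup>2) + (- 2 * int n) * int k)"
    proof -
      have "(q powi (- 2 * int n)) ^ k = q powi (- 2 * int n * int k)"
        by (simp only: power_int_mult power_int_of_nat)
      moreover have "q \<noteq> 0" using q by simp
      ultimately show ?thesis by (simp only: power_int_add power_int_of_nat simp_thms)
    qed
    also have "int (k\<^sup>2) + (- 2 * int n) * int k = (int k - int n)\<^sup>2 + - int (n\<^sup>2)"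
      by (simp add: power2_eq_square algebra_simps)
    also have "q powi \<dots> = q powi ((int k - int n)\<^sup>2) / q ^ n\<^sup>2"
    proof -
      have "q \<noteq> 0" using q by simp
      thus ?thesis
        by (simp only: power_int_add power_int_minus power_int_of_nat divide_inverse simp_thms)
    qed
    finally have 1: "q ^ k\<^sup>2 * (q powi (- 2 * int n)) ^ k = q powi ((int k - int n)\<^sup>2) / q ^ n\<^sup>2" .
    have "(- z) powi (int n + (int k - int n)) = (- z) powi int n * (- z) powi (int k - int n)"
      by (rule power_int_add) (use z in auto)
    hence 2: "(- z) ^ k = (- z) ^ n * (- z) powi (int k - int n)" by simp
    have "of_real (q ^ k\<^sup>2 / qpoch q q k) * (- (of_real (q powi (- 2 * int n)) * z)) ^ k =
       of_real ((q ^ k\<^sup>2 * (q powi (- 2 * int n)) ^ k) / qpoch q q k) * (- z) ^ k"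
      by (simp only: mult_minus_right[symmetric] power_mult_distrib of_real_mult of_real_divide of_real_power) simp
    also have "\<dots> = of_real (q powi ((int k - int n)\<^sup>2) / q ^ n\<^sup>2 / qpoch q q k) * ((- z) ^ n * (- z) powi (int k - int n))"
      unfolding 1 2 ..
    also have "\<dots> = ((- z) ^ n / of_real (qpoch_inf q q * q ^ n\<^sup>2)) * a (int k - int n)"
      using Q by (simp add: a_def d_def)
    finally show ?thesis by simp
  qed
  ultimately show ?thesis by simp
qed

text \<open>Write m for n div 2. For j >= -m the tail product has index at least n/2, which gives
  the first error term. For j < -m the coefficient deviates from 1 by at most 1, and j^2 >= m^2 +
  (j+m)^2 extracts q^(m^2)/|z|^m from the term. Each half is then dominated by a complete theta3
  series, the second one translated by m.\<close>

theorem ramanujan_A_expansion: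
  fixes z :: complex and q :: real
  assumes q: "0 < q" "q < 1" and z: "z \<noteq> 0"
  obtains e where
    "\<And>n. (\<lambda>k. of_real (q ^ k\<^sup>2 / qpoch q q k) * (- (of_real (q powi (- 2 * int n)) * z)) ^ k) sums
      ((- z) ^ n * (theta4 (inverse z) q + e n) / of_real (qpoch_inf q q * q ^ n\<^sup>2))"
    "\<And>n. cmod (e n) \<le> theta3 (inverse (cmod z)) q *
            (q powr (real n / 2) / (1 - q) + q ^ (n div 2)\<^sup>2 / cmod z ^ (n div 2))"
proof -
  define d where "d m = (if m < 0 then 0 else qpoch_inf q q / qpoch q q (nat m))" for m :: int
  define th where "th j = q powi j\<^sup>2 * cmod z powi j" for j :: int
  have th: "(th has_sum theta3 (inverse (cmod z)) q) UNIV"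
    unfolding th_def using theta3_inverse_has_sum[of q "cmod z"] q z by simp
  have th0: "th j \<ge> 0" for j using q by (simp add: th_def)
  have dm: "0 \<le> d m" "d m \<le> 1" for m
    using qpoch_inf_ratio(1)[OF q] qpoch_inf_pos[OF q] qpoch_self_pos[OF q] by (auto simp: d_def less_imp_le)
  define a where "a n j = of_real (q powi j\<^sup>2 * d (int n + j)) * (- z) powi j" for n j
  have "norm (a n j) \<le> th j" for n j
  proof -
    have "norm (a n j) = d (int n + j) * th j"
      using q dm[of "int n + j"] by (simp add: a_def th_def norm_mult norm_power_int)
    thus ?thesis using dm[of "int n + j"] th0[of j] by (simp add: mult_left_le_one_le)
  qed
  hence asum: "(a n has_sum infsum (a n) UNIV) UNIV" for n
    using summable_on_bound[OF has_sum_imp_summable[OF th], of "a n"] by (intro has_sum_infsum) auto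
  define e where "e n = infsum (a n) UNIV - theta4 (inverse z) q" for n
  have "(\<lambda>k. of_real (q ^ k\<^sup>2 / qpoch q q k) * (- (of_real (q powi (- 2 * int n)) * z)) ^ k) sums
      ((- z) ^ n * (theta4 (inverse z) q + e n) / of_real (qpoch_inf q q * q ^ n\<^sup>2))" for n
    using ramanujan_A_shift[OF q z asum[of n, unfolded a_def d_def]]
    by (simp only: e_def a_def[abs_def] d_def add_diff_eq add_diff_cancel_left')
  moreover have "cmod (e n) \<le> theta3 (inverse (cmod z)) q *
            (q powr (real n / 2) / (1 - q) + q ^ (n div 2)\<^sup>2 / cmod z ^ (n div 2))" for n
  proof -
    define m where "m = n div 2"
    define A where "A = q powr (real n / 2) / (1 - q)"
    define B where "B = q ^ m\<^sup>2 / cmod z ^ m"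
    have AB: "A \<ge> 0" "B \<ge> 0" using q by (simp_all add: A_def B_def)
    have sum_e: "((\<lambda>j. a n j - of_real (q powi j\<^sup>2) * (- z) powi j) has_sum e n) UNIV"
      unfolding e_def diff_conv_add_uminus
      by (intro has_sum_add has_sum_uminusI asum theta4_inverse_has_sum q z)
    have "(th has_sum theta3 (inverse (cmod z)) q) UNIV \<longleftrightarrow>
        ((\<lambda>j. th (j + int m)) has_sum theta3 (inverse (cmod z)) q) UNIV"
      by (rule has_sum_reindex_bij_witness[of _ "\<lambda>j. j + int m" "\<lambda>j. j - int m"]) auto
    with th have th': "((\<lambda>j. th (j + int m)) has_sum theta3 (inverse (cmod z)) q) UNIV" by simp
    \<comment> \<open>Translation by m does not change the value of the bilateral sum, so both
      majorants contribute the same theta3 factor.\<close>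
    have sum_AB: "((\<lambda>j. A * th j + B * th (j + int m)) has_sum
        (A * theta3 (inverse (cmod z)) q + B * theta3 (inverse (cmod z)) q)) UNIV"
      by (intro has_sum_add has_sum_cmult_right th th')
    have "norm (a n j - of_real (q powi j\<^sup>2) * (- z) powi j) \<le> A * th j + B * th (j + int m)" for j
    proof -
      have eq: "norm (a n j - of_real (q powi j\<^sup>2) * (- z) powi j) = (1 - d (int n + j)) * th j"
      proof -
        have "a n j - of_real (q powi j\<^sup>2) * (- z) powi j = of_real (q powi j\<^sup>2 * (d (int n + j) - 1)) * (- z) powi j"
          by (simp add: a_def algebra_simps)
        hence "norm (a n j - of_real (q powi j\<^sup>2) * (- z) powi j) =
            \<bar>q powi j\<^sup>2\<bar> * \<bar>d (int n + j) - 1\<bar> * cmod z powi j"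
          by (simp only: norm_mult norm_of_real norm_power_int norm_minus_cancel abs_mult)
        thus ?thesis using dm[of "int n + j"] q by (simp add: th_def)
      qed
      show ?thesis
      proof (cases "j \<ge> - int m")
        case True
        define k where "k = nat (int n + j)"
        have k: "\<not> int n + j < 0" "real k \<ge> real n - real m"
          using True by (auto simp: k_def m_def)
        have "1 - d (int n + j) \<le> q ^ Suc k / (1 - q)"
          using qpoch_inf_ratio(2)[OF q, of k] k(1) by (simp add: d_def k_def)
        also have "q ^ Suc k = q powr real (Suc k)" using q by (simp only: powr_realpow)
        also have "\<dots> / (1 - q) \<le> A" unfolding A_def
        proof (intro divide_right_mono powr_mono')
          have "real m \<le> real n / 2" unfolding m_def by linarith
          thus "real n / 2 \<le> real (Suc k)" using k(2) by simp
        qed (use q in auto)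
        finally have "(1 - d (int n + j)) * th j \<le> A * th j" using th0 by (rule mult_right_mono)
        also have "\<dots> \<le> A * th j + B * th (j + int m)" using AB th0 by simp
        finally show ?thesis unfolding eq .
      next
        case False
        have "(1 - d (int n + j)) * th j \<le> th j"
          using dm[of "int n + j"] th0[of j] by (simp add: mult_left_le_one_le)
        also have "th j \<le> B * th (j + int m)"
        proof -
          have "cmod z powi j = cmod z powi (j + int m) / cmod z ^ m"
            using z by (simp add: power_int_add)
          moreover have "q powi j\<^sup>2 \<le> q powi (int m ^ 2 + (j + int m)\<^sup>2)"
          proof (rule power_int_decreasing)
            \<comment> \<open>Both -m and j + m are nonpositive here, and their doubled product is
              exactly j^2 - m^2 - (j+m)^2.\<close>
            have "0 \<le> (- int m) * (j + int m) * 2" using False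
              by (intro mult_nonneg_nonneg mult_nonpos_nonpos) auto
            thus "int m ^ 2 + (j + int m)\<^sup>2 \<le> j\<^sup>2" by (simp add: power2_eq_square algebra_simps)
          qed (use q in auto)
          hence "q powi j\<^sup>2 \<le> q ^ m\<^sup>2 * q powi (j + int m)\<^sup>2"
            using q power_int_of_nat[of q "m\<^sup>2"] by (simp add: power_int_add)
          ultimately have "th j \<le> (q ^ m\<^sup>2 * q powi (j + int m)\<^sup>2) * (cmod z powi (j + int m) / cmod z ^ m)"
            unfolding th_def by (simp only:) (intro mult_right_mono, auto)
          thus ?thesis by (simp add: B_def th_def mult_ac)
        qed
        also have "\<dots> \<le> A * th j + B * th (j + int m)" using AB th0 by simp
        finally show ?thesis unfolding eq .
      qed
    qed
    with sum_e sum_AB have "norm (e n) \<le> A * theta3 (inverse (cmod z)) q + B * theta3 (inverse (cmod z)) q"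
      by (rule norm_infsum_le)
    thus ?thesis by (simp add: A_def B_def m_def algebra_simps)
  qed
  ultimately show thesis by (rule that)
qed

section \<open>Asymptotics as \<open>q\<close> tends to \<open>1\<close>\<close>

text \<open>Splitting exp(-N w) into exp(-N w0) and exp(-N (w - w0)) and using N >= 1 in the second
  factor only leaves exp(w0 - w), which is summable with a sum independent of N. \<open>F\<close>
  holds the frequencies kept explicitly and \<open>w0\<close> is the smallest weight allowed outside
  it.\<close>

lemma infsum_gaussian_tail:
  fixes f w :: "'a \<Rightarrow> real"
  assumes N: "N \<ge> 1" and F: "finite F"
    and summ: "(\<lambda>k. exp (- w k)) summable_on UNIV"
    and f: "\<And>k. \<bar>f k\<bar> \<le> exp (- N * w k)"
    and w: "\<And>k. k \<notin> F \<Longrightarrow> w0 \<le> w k" "\<And>k. 0 \<le> w k"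
  shows "\<bar>infsum f UNIV - sum f F\<bar> \<le> (exp w0 * (\<Sum>\<^sub>\<infinity>k. exp (- w k))) * exp (- N * w0)"
proof -
  have "f summable_on UNIV"
  proof (rule summable_on_bound[OF summ])
    fix k
    have "w k * 1 \<le> w k * N" using N w(2) by (intro mult_left_mono) auto
    hence "exp (- N * w k) \<le> exp (- w k)" by (simp add: mult.commute)
    thus "norm (f k) \<le> exp (- w k)" unfolding real_norm_def by (rule order_trans[OF f])
  qed
  note fs = this
  have fF: "f summable_on (- F)" by (rule summable_on_subset_banach[OF fs]) simp
  have "infsum f (F \<union> - F) = infsum f F + infsum f (- F)"
    by (rule infsum_Un_disjoint[OF summable_on_finite[OF F] fF]) simp
  hence "infsum f UNIV = sum f F + infsum f (- F)" using F by simp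
  moreover have "norm (infsum f (- F)) \<le> (exp w0 * (\<Sum>\<^sub>\<infinity>k\<in>-F. exp (- w k))) * exp (- N * w0)"
  proof (rule norm_infsum_le)
    show "(f has_sum infsum f (- F)) (- F)"
      by (rule has_sum_infsum[OF fF])
    show "((\<lambda>k. exp w0 * exp (- w k) * exp (- N * w0)) has_sum
        (exp w0 * (\<Sum>\<^sub>\<infinity>k\<in>-F. exp (- w k))) * exp (- N * w0)) (- F)"
      by (intro has_sum_cmult_left has_sum_cmult_right has_sum_infsum summable_on_subset_banach[OF summ]) auto
    fix k assume "k \<in> - F"
    hence "1 * (w k - w0) \<le> N * (w k - w0)" using w(1)[of k] N by (intro mult_right_mono) auto
    hence "- N * w k \<le> w0 + - w k + - N * w0" by (simp add: algebra_simps)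
    hence "exp (- N * w k) \<le> exp w0 * exp (- w k) * exp (- N * w0)" by (simp only: exp_add[symmetric] exp_le_cancel_iff)
    thus "norm (f k) \<le> exp w0 * exp (- w k) * exp (- N * w0)" using f[of k] by simp
  qed
  moreover have "(\<Sum>\<^sub>\<infinity>k\<in>-F. exp (- w k)) \<le> (\<Sum>\<^sub>\<infinity>k. exp (- w k))"
    by (intro infsum_mono2 summable_on_subset_banach[OF summ] summ) auto
  hence "(exp w0 * (\<Sum>\<^sub>\<infinity>k\<in>-F. exp (- w k))) * exp (- N * w0) \<le> (exp w0 * (\<Sum>\<^sub>\<infinity>k. exp (- w k))) * exp (- N * w0)"
    by (intro mult_right_mono mult_left_mono) auto
  ultimately show ?thesis unfolding real_norm_def by linarith
qed

lemma odd_square_ge: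
  fixes j b :: int
  assumes "\<bar>2 * j + 1\<bar> \<ge> b" "b \<ge> 0"
  shows "(of_int (2 * j + 1))\<^sup>2 \<ge> (of_int b :: real)\<^sup>2"
proof -
  have "b\<^sup>2 \<le> \<bar>2 * j + 1\<bar>\<^sup>2" using assms by (intro power_mono) auto
  hence "b\<^sup>2 \<le> (2 * j + 1)\<^sup>2" by simp
  thus ?thesis by (simp only: of_int_power[symmetric] of_int_le_iff)
qed

lemma summable_on_odd_gauss:
  fixes c :: real
  assumes "c > 0"
  shows "(\<lambda>j::int. exp (- (c * (of_int (2 * j + 1))\<^sup>2))) summable_on UNIV"
proof -
  have "(\<lambda>j::int. exp (- (4 * c) * (1 / 2 + of_int j)\<^sup>2)) summable_on UNIV"
    using assms by (intro summable_on_gauss) auto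
  moreover have "- (4 * c) * (1 / 2 + of_int j)\<^sup>2 = - (c * (of_int (2 * j + 1))\<^sup>2)" for j
    by (simp add: power2_eq_square algebra_simps)
  ultimately show ?thesis by (simp only:)
qed

lemma theta_exp_complete_square:
  fixes u N :: real
  assumes "N > 0"
  shows "exp (- pi / N) powi k\<^sup>2 * exp (2 * pi * u) powi k =
    exp (pi * N * u\<^sup>2) * exp (- pi * (1 / N) * (- u * N + of_int k)\<^sup>2)"
proof -
  have "exp (- pi / N) powi k\<^sup>2 * exp (2 * pi * u) powi k = exp (pi * (- (of_int k)\<^sup>2 / N + 2 * u * of_int k))"
    by (subst theta_term_exp) (simp_all add: algebra_simps)
  also have "pi * (- (of_int k)\<^sup>2 / N + 2 * u * of_int k) = pi * N * u\<^sup>2 + - pi * (1 / N) * (- u * N + of_int k)\<^sup>2"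
    using assms by (simp add: power2_eq_square field_simps)
  finally show ?thesis by (simp only: exp_add)
qed

text \<open>Completing the square gives the prefactor exp(pi N u^2) and a periodised Gaussian with t
  = 1/N. Its transform has value 1 at frequency 0, and all other frequencies have weight at least
  pi.\<close>

lemma theta3_asymptotics:
  obtains C :: real where "C \<ge> 0"
    "\<And>N u. N \<ge> 1 \<Longrightarrow> \<exists>\<alpha>. \<bar>\<alpha>\<bar> \<le> C * exp (- pi * N) \<and>
      theta3 (inverse (exp (2 * pi * u))) (exp (- pi / N)) = exp (pi * N * u\<^sup>2) * sqrt N * (1 + \<alpha>)"
proof
  define C where "C = exp pi * (\<Sum>\<^sub>\<infinity>k::int. exp (- (pi * (of_int k)\<^sup>2)))"
  show "C \<ge> 0" by (simp add: C_def infsum_nonneg)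
  fix N u :: real assume N: "N \<ge> 1"
  define f where "f m = exp (- pi * (of_int m)\<^sup>2 / (1 / N)) * cos (2 * pi * of_int m * (- u * N))" for m :: int
  define \<alpha> where "\<alpha> = infsum f UNIV - 1"
  have summ: "(\<lambda>k::int. exp (- (pi * (of_int k)\<^sup>2))) summable_on UNIV"
    using summable_on_gauss[of pi 0] by simp
  have "\<bar>infsum f UNIV - sum f {0}\<bar> \<le> exp pi * (\<Sum>\<^sub>\<infinity>k::int. exp (- (pi * (of_int k)\<^sup>2))) * exp (- N * pi)"
  proof (rule infsum_gaussian_tail[OF N _ summ])
    fix k :: int
    have "exp (- N * (pi * (of_int k)\<^sup>2)) * \<bar>cos (2 * pi * of_int k * (- u * N))\<bar> \<le> exp (- N * (pi * (of_int k)\<^sup>2)) * 1"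
      by (intro mult_left_mono) auto
    thus "\<bar>f k\<bar> \<le> exp (- N * (pi * (of_int k)\<^sup>2))" by (simp add: f_def abs_mult mult_ac)
    assume "k \<notin> {0}"
    hence "k\<^sup>2 \<ge> 1" by (simp add: int_one_le_iff_zero_less)
    hence "(of_int k :: real)\<^sup>2 \<ge> 1" by (simp only: of_int_power[symmetric] of_int_1_le_iff)
    thus "pi \<le> pi * (of_int k)\<^sup>2" by simp
  qed auto
  hence "\<bar>\<alpha>\<bar> \<le> C * exp (- pi * N)" by (simp add: \<alpha>_def C_def f_def mult.commute)
  moreover have "theta3 (inverse (exp (2 * pi * u))) (exp (- pi / N)) = exp (pi * N * u\<^sup>2) * sqrt N * (1 + \<alpha>)"
  proof -
    have "((\<lambda>k. exp (- pi / N) powi k\<^sup>2 * exp (2 * pi * u) powi k) has_sum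
        theta3 (inverse (exp (2 * pi * u))) (exp (- pi / N))) UNIV"
      using N by (intro theta3_inverse_has_sum) auto
    hence "((\<lambda>k::int. exp (pi * N * u\<^sup>2) * exp (- pi * (1 / N) * (- u * N + of_int k)\<^sup>2)) has_sum
        theta3 (inverse (exp (2 * pi * u))) (exp (- pi / N))) UNIV"
      using N by (subst (asm) theta_exp_complete_square) auto
    hence "theta3 (inverse (exp (2 * pi * u))) (exp (- pi / N)) =
        (\<Sum>\<^sub>\<infinity>k::int. exp (pi * N * u\<^sup>2) * exp (- pi * (1 / N) * (- u * N + of_int k)\<^sup>2))"
      by (rule infsumI[symmetric])
    also have "\<dots> = exp (pi * N * u\<^sup>2) * gauss_sum (1 / N) (- u * N)"
      unfolding gauss_sum_def by (rule infsum_cmult_right')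
    also have "gauss_sum (1 / N) (- u * N) = sqrt N * infsum f UNIV"
    proof -
      have "(f has_sum (sqrt (1 / N) * gauss_sum (1 / N) (- u * N))) UNIV"
        unfolding f_def by (rule gauss_sum_transformation) (use N in auto)
      hence "infsum f UNIV = sqrt (1 / N) * gauss_sum (1 / N) (- u * N)" by (rule infsumI)
      thus ?thesis using N by (simp add: real_sqrt_divide)
    qed
    finally show ?thesis by (simp add: \<alpha>_def)
  qed
  ultimately show "\<exists>\<alpha>. \<bar>\<alpha>\<bar> \<le> C * exp (- pi * N) \<and>
      theta3 (inverse (exp (2 * pi * u))) (exp (- pi / N)) = exp (pi * N * u\<^sup>2) * sqrt N * (1 + \<alpha>)" by blast
qed

text \<open>The alternating sign leaves only odd frequencies. Those at 1 and -1, indices j = 0 and j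
  = -1, combine to the cosine with amplitude 2 exp(-pi N/4); the next ones carry exp(-9 pi N/4),
  hence exp(-2 pi N) once that amplitude is factored out.\<close>

lemma theta4_asymptotics:
  obtains C :: real where "C \<ge> 0"
    "\<And>N u. N \<ge> 1 \<Longrightarrow> \<exists>\<gamma>. \<bar>\<gamma>\<bar> \<le> C * exp (- 2 * pi * N) \<and>
      theta4 (inverse (complex_of_real (exp (2 * pi * u)))) (exp (- pi / N)) =
        of_real (exp (pi * N * u\<^sup>2) * sqrt N * (2 * exp (- pi * N / 4) * (cos (pi * N * u) + \<gamma>)))"
proof
  let ?w = "\<lambda>j::int. pi / 4 * (of_int (2 * j + 1))\<^sup>2"
  define C where "C = exp (9 * pi / 4) * (\<Sum>\<^sub>\<infinity>j. exp (- ?w j))"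
  show C0: "C \<ge> 0" by (simp add: C_def infsum_nonneg)
  fix N u :: real assume N: "N \<ge> 1"
  define f where "f j = exp (- pi * (of_int (2 * j + 1))\<^sup>2 / (4 * (1 / N))) * cos (pi * of_int (2 * j + 1) * (- u * N))" for j :: int
  define \<gamma> where "\<gamma> = (infsum f UNIV / (2 * exp (- pi * N / 4))) - cos (pi * N * u)"
  have f: "sum f {0, -1} = 2 * exp (- pi * N / 4) * cos (pi * N * u)"
    by (simp add: f_def mult_ac)
  have "\<bar>infsum f UNIV - sum f {0, -1}\<bar> \<le> exp (9 * pi / 4) * (\<Sum>\<^sub>\<infinity>j. exp (- ?w j)) * exp (- N * (9 * pi / 4))"
  proof (rule infsum_gaussian_tail[OF N _ summable_on_odd_gauss])
    fix j :: int
    have "exp (- N * ?w j) * \<bar>cos (pi * of_int (2 * j + 1) * (- u * N))\<bar> \<le> exp (- N * ?w j) * 1"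
      by (intro mult_left_mono) auto
    moreover have "- pi * (of_int (2 * j + 1))\<^sup>2 / (4 * (1 / N)) = - N * ?w j" by simp
    ultimately show "\<bar>f j\<bar> \<le> exp (- N * ?w j)" unfolding f_def abs_mult abs_exp_cancel by (simp only: mult_1_right)
    assume "j \<notin> {0, -1}"
    hence "\<bar>2 * j + 1\<bar> \<ge> 3" by auto
    from odd_square_ge[OF this] show "9 * pi / 4 \<le> ?w j" by simp
  qed auto
  also have "\<dots> = C * exp (- 2 * pi * N) * exp (- pi * N / 4)"
    by (simp add: C_def mult_ac flip: exp_add)
  finally have "\<bar>infsum f UNIV - sum f {0, -1}\<bar> / (2 * exp (- pi * N / 4)) \<le> C * exp (- 2 * pi * N) / 2"
    by (simp add: divide_simps mult_ac)
  moreover have "\<bar>infsum f UNIV - sum f {0, -1}\<bar> / (2 * exp (- pi * N / 4)) = \<bar>\<gamma>\<bar>"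
  proof -
    have "\<gamma> = (infsum f UNIV - sum f {0, -1}) / (2 * exp (- pi * N / 4))"
      unfolding f \<gamma>_def by (simp add: diff_divide_distrib)
    thus ?thesis by (simp add: abs_divide)
  qed
  moreover have "C * exp (- 2 * pi * N) / 2 \<le> C * exp (- 2 * pi * N)" using C0 by simp
  ultimately have 1: "\<bar>\<gamma>\<bar> \<le> C * exp (- 2 * pi * N)" by linarith
  have "((\<lambda>k::int. complex_of_real (exp (- pi / N) powi k\<^sup>2) * (- of_real (exp (2 * pi * u))) powi k) has_sum
      theta4 (inverse (complex_of_real (exp (2 * pi * u)))) (exp (- pi / N))) UNIV"
    using N by (intro theta4_inverse_has_sum) auto
  also have "(\<lambda>k::int. complex_of_real (exp (- pi / N) powi k\<^sup>2) * (- of_real (exp (2 * pi * u))) powi k) =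
     (\<lambda>k. of_real (exp (pi * N * u\<^sup>2) * ((-1) powi k * exp (- pi * (1 / N) * (- u * N + of_int k)\<^sup>2))))"
  proof
    fix k :: int
    have "(- complex_of_real (exp (2 * pi * u))) powi k = of_real ((-1) powi k * exp (2 * pi * u) powi k)"
      unfolding power_int_mult_distrib[symmetric] by simp
    hence "complex_of_real (exp (- pi / N) powi k\<^sup>2) * (- of_real (exp (2 * pi * u))) powi k =
      of_real ((-1) powi k * (exp (- pi / N) powi k\<^sup>2 * exp (2 * pi * u) powi k))"
      by (simp only: of_real_mult mult_ac)
    also have "\<dots> = of_real ((-1) powi k * (exp (pi * N * u\<^sup>2) * exp (- pi * (1 / N) * (- u * N + of_int k)\<^sup>2)))"
      using N by (subst theta_exp_complete_square) auto
    finally show "complex_of_real (exp (- pi / N) powi k\<^sup>2) * (- of_real (exp (2 * pi * u))) powi k =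
      of_real (exp (pi * N * u\<^sup>2) * ((-1) powi k * exp (- pi * (1 / N) * (- u * N + of_int k)\<^sup>2)))"
      by (simp only: mult_ac)
  qed
  finally have "theta4 (inverse (complex_of_real (exp (2 * pi * u)))) (exp (- pi / N)) =
     (\<Sum>\<^sub>\<infinity>k::int. of_real (exp (pi * N * u\<^sup>2) * ((-1) powi k * exp (- pi * (1 / N) * (- u * N + of_int k)\<^sup>2))))"
    by (rule infsumI[symmetric])
  also have "\<dots> = of_real (\<Sum>\<^sub>\<infinity>k::int. exp (pi * N * u\<^sup>2) * ((-1) powi k * exp (- pi * (1 / N) * (- u * N + of_int k)\<^sup>2)))"
  proof (rule infsumI[OF has_sum_of_real[OF has_sum_infsum]])
    have "(\<lambda>k::int. exp (- pi * (1 / N) * (- u * N + of_int k)\<^sup>2)) summable_on UNIV"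
      using N by (intro gauss_sum_summable) auto
    hence "(\<lambda>k::int. (-1) powi k * exp (- pi * (1 / N) * (- u * N + of_int k)\<^sup>2)) summable_on UNIV"
      by (rule summable_on_bound) (simp add: abs_mult flip: power_int_abs)
    thus "(\<lambda>k::int. exp (pi * N * u\<^sup>2) * ((-1) powi k * exp (- pi * (1 / N) * (- u * N + of_int k)\<^sup>2))) summable_on UNIV"
      by (rule summable_on_cmult_right)
  qed
  also have "\<dots> = of_real (exp (pi * N * u\<^sup>2) * (\<Sum>\<^sub>\<infinity>k::int. (-1) powi k * exp (- pi * (1 / N) * (- u * N + of_int k)\<^sup>2)))"
    by (simp only: infsum_cmult_right')
  also have "(\<Sum>\<^sub>\<infinity>k::int. (-1) powi k * exp (- pi * (1 / N) * (- u * N + of_int k)\<^sup>2)) = sqrt N * infsum f UNIV"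
  proof -
    have "sqrt (1 / N) * (\<Sum>\<^sub>\<infinity>k::int. (-1) powi k * exp (- pi * (1 / N) * (- u * N + of_int k)\<^sup>2)) = infsum f UNIV"
      unfolding f_def by (rule alternating_gauss_sum_transformation) (use N in auto)
    from this[symmetric] show ?thesis using N by (simp add: real_sqrt_divide)
  qed
  also have "infsum f UNIV = 2 * exp (- pi * N / 4) * (cos (pi * N * u) + \<gamma>)" by (simp add: \<gamma>_def)
  finally have "theta4 (inverse (complex_of_real (exp (2 * pi * u)))) (exp (- pi / N)) =
      of_real (exp (pi * N * u\<^sup>2) * sqrt N * (2 * exp (- pi * N / 4) * (cos (pi * N * u) + \<gamma>)))"
    by (simp only: mult.assoc)
  with 1 show "\<exists>\<gamma>. \<bar>\<gamma>\<bar> \<le> C * exp (- 2 * pi * N) \<and>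
      theta4 (inverse (complex_of_real (exp (2 * pi * u)))) (exp (- pi / N)) =
        of_real (exp (pi * N * u\<^sup>2) * sqrt N * (2 * exp (- pi * N / 4) * (cos (pi * N * u) + \<gamma>)))" by blast
qed

text \<open>The frequencies \<open>\<plusminus>3\<close> drop out of the transformed pentagonal series because \<open>cos (pi / 2) = 0\<close>.\<close>

lemma qpoch_inf_asymptotics:
  obtains C :: real where "C \<ge> 0"
    "\<And>N. N \<ge> 1 \<Longrightarrow> \<exists>\<beta>. \<bar>\<beta>\<bar> \<le> C * exp (- 4 * pi * N) \<and>
      qpoch_inf (exp (- pi / N)) (exp (- pi / N)) =
        sqrt 2 * sqrt N * exp (pi / N / 24 - pi * N / 6) * (1 + \<beta>)"
proof
  let ?w = "\<lambda>j::int. pi / 6 * (of_int (2 * j + 1))\<^sup>2"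
  \<comment> \<open>With weight pi/6 times the squared frequency, 25 pi/6 belongs to frequencies 5
    and -5, the first ones not listed explicitly. Relative to the leading weight pi/6 this gains
    exactly 4 pi.\<close>
  define C where "C = exp (25 * pi / 6) * (\<Sum>\<^sub>\<infinity>j. exp (- ?w j))"
  show C0: "C \<ge> 0" by (simp add: C_def infsum_nonneg)
  fix N :: real assume N: "N \<ge> 1"
  \<comment> \<open>The parameters come from k(3k-1)/2 = (3/2)(k - 1/6)^2 - 1/24: they are t =
    3/(2N) and x = -1/6, and the constant term produces exp(pi/(24 N)). At the leading frequencies
    the cosine is cos(pi/6), the source of \<open>sqrt 3\<close>.\<close>
  define f where "f j = exp (- pi * (of_int (2 * j + 1))\<^sup>2 / (4 * (3 / (2 * N)))) * cos (pi * of_int (2 * j + 1) * (- 1 / 6))" for j :: int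
  define \<beta> where "\<beta> = infsum f UNIV / (sqrt 3 * exp (- pi * N / 6)) - 1"
  have f: "sum f {0, -1, 1, -2} = sqrt 3 * exp (- pi * N / 6)"
  proof -
    have "pi * 3 * (- 1 / 6) = - (pi / 2)" "pi * (-3) * (- 1 / 6) = pi / 2" by simp_all
    hence "cos (pi * 3 * (- 1 / 6)) = 0" "cos (pi * (-3) * (- 1 / 6)) = 0"
      by (simp_all only: cos_minus cos_pi_half)
    hence "f 1 = 0" "f (-2) = 0" by (simp_all add: f_def)
    moreover have "f 0 = sqrt 3 / 2 * exp (- pi * N / 6)" "f (-1) = sqrt 3 / 2 * exp (- pi * N / 6)"
      by (simp_all add: f_def cos_30 mult.commute)
    ultimately show ?thesis by simp
  qed
  have "\<bar>infsum f UNIV - sum f {0, -1, 1, -2}\<bar> \<le> exp (25 * pi / 6) * (\<Sum>\<^sub>\<infinity>j. exp (- ?w j)) * exp (- N * (25 * pi / 6))"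
  proof (rule infsum_gaussian_tail[OF N _ summable_on_odd_gauss])
    fix j :: int
    have "exp (- N * ?w j) * \<bar>cos (pi * of_int (2 * j + 1) * (- 1 / 6))\<bar> \<le> exp (- N * ?w j) * 1"
      by (intro mult_left_mono) auto
    moreover have "- pi * (of_int (2 * j + 1))\<^sup>2 / (4 * (3 / (2 * N))) = - N * ?w j"
      using N by (simp add: field_simps)
    ultimately show "\<bar>f j\<bar> \<le> exp (- N * ?w j)" unfolding f_def abs_mult abs_exp_cancel by (simp only: mult_1_right)
    assume "j \<notin> {0, -1, 1, -2}"
    hence "\<bar>2 * j + 1\<bar> \<ge> 5" by auto
    from odd_square_ge[OF this] show "25 * pi / 6 \<le> ?w j" by simp
  qed auto
  also have "\<dots> = C * exp (- 4 * pi * N) * exp (- pi * N / 6)"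
    by (simp add: C_def mult_ac flip: exp_add)
  also have "\<dots> \<le> C * exp (- 4 * pi * N) * (sqrt 3 * exp (- pi * N / 6))"
    using C0 by (intro mult_left_mono) auto
  finally have "\<bar>infsum f UNIV - sum f {0, -1, 1, -2}\<bar> / (sqrt 3 * exp (- pi * N / 6)) \<le> C * exp (- 4 * pi * N)"
    by (simp add: divide_simps mult_ac)
  moreover have "\<bar>infsum f UNIV - sum f {0, -1, 1, -2}\<bar> / (sqrt 3 * exp (- pi * N / 6)) = \<bar>\<beta>\<bar>"
  proof -
    have "\<beta> = (infsum f UNIV - sum f {0, -1, 1, -2}) / (sqrt 3 * exp (- pi * N / 6))"
      unfolding f \<beta>_def by (simp add: diff_divide_distrib)
    thus ?thesis by (simp add: abs_divide)
  qed
  ultimately have 1: "\<bar>\<beta>\<bar> \<le> C * exp (- 4 * pi * N)" by simp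
  define r where "r = exp (- pi / (2 * N))"
  have r: "0 < r" "r < 1" "r\<^sup>2 = exp (- pi / N)" using N by (simp_all add: r_def flip: exp_of_nat_mult)
  have "qpoch_inf (exp (- pi / N)) (exp (- pi / N)) = (\<Sum>\<^sub>\<infinity>k::int. (-1) powi k * r powi (k * (3 * k - 1)))"
    using pentagonal_number[OF r(1,2)] by (simp add: r(3) infsumI)
  also have "\<dots> = (\<Sum>\<^sub>\<infinity>k::int. exp (pi / N / 24) * ((-1) powi k * exp (- pi * (3 / (2 * N)) * (- 1 / 6 + of_int k)\<^sup>2)))"
  proof (rule infsum_cong)
    fix k :: int
    have "r powi (k * (3 * k - 1)) = exp (of_int (k * (3 * k - 1)) * (- pi / (2 * N)))"
      using r(1) by (subst powr_real_of_int'[symmetric]) (auto simp: powr_def r_def)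
    also have "of_int (k * (3 * k - 1)) * (- pi / (2 * N)) = pi / N / 24 + - pi * (3 / (2 * N)) * (- 1 / 6 + of_int k)\<^sup>2"
      using N by (simp add: field_simps power2_eq_square)
    finally show "(-1) powi k * r powi (k * (3 * k - 1)) =
        exp (pi / N / 24) * ((-1) powi k * exp (- pi * (3 / (2 * N)) * (- 1 / 6 + of_int k)\<^sup>2))"
      by (simp only: exp_add mult_ac)
  qed
  also have "\<dots> = exp (pi / N / 24) * (\<Sum>\<^sub>\<infinity>k::int. (-1) powi k * exp (- pi * (3 / (2 * N)) * (- 1 / 6 + of_int k)\<^sup>2))"
    by (rule infsum_cmult_right')
  also have "(\<Sum>\<^sub>\<infinity>k::int. (-1) powi k * exp (- pi * (3 / (2 * N)) * (- 1 / 6 + of_int k)\<^sup>2)) = sqrt 2 * sqrt N / sqrt 3 * infsum f UNIV"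
  proof -
    have "sqrt (3 / (2 * N)) * (\<Sum>\<^sub>\<infinity>k::int. (-1) powi k * exp (- pi * (3 / (2 * N)) * (- 1 / 6 + of_int k)\<^sup>2)) = infsum f UNIV"
      unfolding f_def by (rule alternating_gauss_sum_transformation) (use N in auto)
    from this[symmetric] show ?thesis using N by (simp add: real_sqrt_divide real_sqrt_mult)
  qed
  also have "infsum f UNIV = sqrt 3 * exp (- pi * N / 6) * (1 + \<beta>)" by (simp add: \<beta>_def)
  also have "exp (pi / N / 24) * (sqrt 2 * sqrt N / sqrt 3 * (sqrt 3 * exp (- pi * N / 6) * (1 + \<beta>))) =
      sqrt 2 * sqrt N * (exp (pi / N / 24) * exp (- pi * N / 6)) * (1 + \<beta>)" by simp
  also have "exp (pi / N / 24) * exp (- pi * N / 6) = exp (pi / N / 24 - pi * N / 6)"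
    by (simp flip: exp_add)
  finally show "\<exists>\<beta>. \<bar>\<beta>\<bar> \<le> C * exp (- 4 * pi * N) \<and>
      qpoch_inf (exp (- pi / N)) (exp (- pi / N)) =
        sqrt 2 * sqrt N * exp (pi / N / 24 - pi * N / 6) * (1 + \<beta>)" using 1 by blast
qed

section \<open>Remainder estimate and the two asymptotic formulas\<close>

lemma sums_Reals:
  fixes f :: "nat \<Rightarrow> complex"
  assumes "f sums S" "\<And>k. f k \<in> \<real>"
  shows "S \<in> \<real>"
proof -
  have "(\<lambda>k. Im (f k)) sums Im S" using assms(1) by (rule sums_Im)
  moreover have "Im (f k) = 0" for k using assms(2) by (auto simp: complex_is_Real_iff)
  ultimately have "(\<lambda>k. 0) sums Im S" by simp
  hence "Im S = 0" using sums_zero sums_unique2 by blast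
  thus ?thesis by (simp add: complex_is_Real_iff)
qed

lemma ramanujan_A_of_real:
  assumes "(\<lambda>k. complex_of_real (q ^ k\<^sup>2 / qpoch q q k) * (- of_real y) ^ k) sums S"
  shows "ramanujan_A q (of_real y) = S" "S \<in> \<real>"
proof -
  show "ramanujan_A q (of_real y) = S" unfolding ramanujan_A_def using assms by (rule sums_unique[symmetric])
  show "S \<in> \<real>" by (rule sums_Reals[OF assms]) auto
qed

text \<open>As a < 1/2, n^(1-a) outgrows every multiple of N = n^a, so any fixed rate in N could be
  reached. The rate 3 pi is chosen to exceed 2 pi + pi/4: the theta4 case divides the remainder by
  exp(-pi N/4) and still has to reach exp(-2 pi N).\<close>

lemma eventually_remainder_bound:
  fixes a u :: real
  assumes a: "0 < a" "a < 1 / 2"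
  shows "\<forall>\<^sub>F n in sequentially.
    exp (- pi / real n powr a) powr (real n / 2) / (1 - exp (- pi / real n powr a))
      + exp (- pi / real n powr a) ^ (n div 2)\<^sup>2 / exp (2 * pi * u) ^ (n div 2)
    \<le> 2 * exp (- 3 * pi * real n powr a)"
proof -
  \<comment> \<open>The factor 8 makes q^(n/2) = exp(-(pi/2) n^(1-a)) at most exp(-4 pi N); one
    factor exp(pi N) is then spent on 1/(1-q).\<close>
  have e1: "\<forall>\<^sub>F n in sequentially. real n powr (1 - a) \<ge> 8 * real n powr a"
    using a by real_asymp
  \<comment> \<open>With m = n div 2 >= n/3, the second remainder is exp(-pi m (m/N + 2u)). The
    bound 9 makes its exponent at most -3 pi n, which suffices as n >= N.\<close>
  have e2: "\<forall>\<^sub>F n in sequentially. real n powr (1 - a) / 3 + 2 * u \<ge> 9"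
    using a by real_asymp
  from e1 e2 eventually_ge_at_top[of 3] show ?thesis
  proof eventually_elim
    case (elim n)
    define N where "N = real n powr a"
    define q where "q = exp (- pi / N)"
    define m where "m = n div 2"
    have n: "n \<ge> 3" "real n > 0" using elim by auto
    have N1: "N \<ge> 1" unfolding N_def using a n by (intro ge_one_powr_ge_zero) auto
    have nN: "real n / N = real n powr (1 - a)"
      using n by (simp add: N_def powr_diff)
    have q: "0 < q" "q < 1" using N1 by (simp_all add: q_def)
    have Nn: "N \<le> real n" using a n powr_mono[of a 1 "real n"] by (simp add: N_def)
    have "q powr (real n / 2) / (1 - q) \<le> exp (- 3 * pi * N)"
    proof -
      have "1 + pi / N \<le> exp (pi / N)" by (rule exp_ge_add_one_self)
      hence "q \<le> inverse (1 + pi / N)" using N1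
        by (simp add: q_def exp_minus le_imp_inverse_le add_pos_pos)
      moreover have "1 - inverse (1 + pi / N) = (pi / N) / (1 + pi / N)"
      proof -
        have "1 - inverse (1 + w) = w / (1 + w)" if "1 + w > 0" for w :: real
          using that by (simp add: field_simps)
        moreover have "1 + pi / N > 0" using N1 by (intro add_pos_pos) auto
        ultimately show ?thesis by blast
      qed
      ultimately have "1 - q \<ge> (pi / N) / (1 + pi / N)" by linarith
      moreover have "(pi / N) / (1 + pi / N) = pi / (N + pi)" using N1 by (simp add: field_simps add_pos_pos)
      ultimately have "1 - q \<ge> pi / (N + pi)" by simp
      hence "1 / (1 - q) \<le> 1 / (pi / (N + pi))" using N1 q by (intro divide_left_mono) (auto simp: add_pos_pos)
      also have "\<dots> = 1 + N / pi" using N1 by (simp add: field_simps)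
      also have "N / pi \<le> pi * N"
        using N1 pi_ge_two mult_mono[of 1 "pi * pi" N N] mult_mono[of 1 pi 1 pi] by (simp add: field_simps)
      also have "1 + pi * N \<le> exp (pi * N)" by (rule exp_ge_add_one_self)
      finally have 1: "1 / (1 - q) \<le> exp (pi * N)" by simp
      have "q powr (real n / 2) = exp (- (pi / 2 * (real n / N)))"
        by (simp add: powr_def q_def)
      also have "\<dots> \<le> exp (- (4 * pi * N))"
      proof -
        have "pi / 2 * (8 * N) \<le> pi / 2 * (real n / N)"
          using elim(1)[folded N_def nN] by (intro mult_left_mono) auto
        thus ?thesis by (simp add: mult_ac)
      qed
      finally have "q powr (real n / 2) * (1 / (1 - q)) \<le> exp (- (4 * pi * N)) * exp (pi * N)"
        using 1 q by (intro mult_mono) auto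
      thus ?thesis by (simp add: mult_ac flip: exp_add)
    qed
    moreover have "q ^ m\<^sup>2 / exp (2 * pi * u) ^ m \<le> exp (- 3 * pi * N)"
    proof -
      have m: "real m \<ge> real n / 3" using n(1) unfolding m_def by linarith
      have "real m / N + 2 * u \<ge> (real n / 3) / N + 2 * u"
        using m N1 by (intro add_right_mono divide_right_mono) auto
      also have "(real n / 3) / N = (real n / N) / 3" by simp
      finally have "real m / N + 2 * u \<ge> 9" using elim(2) unfolding nN by linarith
      hence "real m * (real m / N + 2 * u) \<ge> real n / 3 * 9" using m n by (intro mult_mono) auto
      hence "real m * (real m / N + 2 * u) \<ge> 3 * N" using Nn by linarith
      hence "pi * (real m * (real m / N + 2 * u)) \<ge> pi * (3 * N)" by (intro mult_left_mono) auto
      moreover have "q ^ m\<^sup>2 / exp (2 * pi * u) ^ m = exp (- (pi * (real m * (real m / N + 2 * u))))"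
        by (simp add: q_def power2_eq_square algebra_simps flip: exp_of_nat_mult exp_diff)
      ultimately show ?thesis by simp
    qed
    ultimately show ?case by (simp add: N_def q_def m_def)
  qed
qed

lemma abs_inverse_one_plus_le:
  fixes \<beta> :: real
  assumes "\<bar>\<beta>\<bar> \<le> 1 / 2"
  shows "\<bar>X / (1 + \<beta>)\<bar> \<le> 2 * \<bar>X\<bar>"
proof -
  have "1 + \<beta> \<ge> 1 / 2" using assms by linarith
  hence "\<bar>X\<bar> * 1 \<le> \<bar>X\<bar> * (2 * (1 + \<beta>))" by (intro mult_left_mono) auto
  thus ?thesis using \<open>1 + \<beta> \<ge> 1 / 2\<close> by (simp add: abs_divide divide_simps mult_ac)
qed

context
  fixes a u :: real
  assumes a: "0 < a" "a < 1 / 2"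
begin

text \<open>\<open>\<sigma> = - 1\<close> and \<open>\<sigma> = 1\<close> select the two halves of part (ii).\<close>

lemma ramanujan_A_at_exp:
  fixes n :: nat and \<sigma> :: real
  defines "N \<equiv> real n powr a"
  defines "q \<equiv> exp (- pi / N)"
  assumes n: "n \<ge> 1" and \<sigma>: "\<bar>\<sigma>\<bar> = 1"
  obtains A \<epsilon> where
    "ramanujan_A q (of_real (\<sigma> * exp (2 * pi * (u + real n powr (1 - a))))) = of_real A"
    "A * qpoch_inf q q = (- \<sigma>) ^ n * exp (pi / N * (N * u + real n)\<^sup>2) / exp (pi * N * u\<^sup>2) *
        (Re (theta4 (inverse (complex_of_real (\<sigma> * exp (2 * pi * u)))) q) + theta3 (inverse (exp (2 * pi * u))) q * \<epsilon>)"
    "\<bar>\<epsilon>\<bar> \<le> q powr (real n / 2) / (1 - q) + q ^ (n div 2)\<^sup>2 / exp (2 * pi * u) ^ (n div 2)"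
proof -
  define x where "x = exp (2 * pi * u)"
  define z where "z = complex_of_real (\<sigma> * x)"
  define G where "G = q powr (real n / 2) / (1 - q) + q ^ (n div 2)\<^sup>2 / x ^ (n div 2)"
  have N: "N > 0" using n by (simp add: N_def)
  have q: "0 < q" "q < 1" using N by (simp_all add: q_def)
  have z: "z \<noteq> 0" "cmod z = x" using \<sigma> by (auto simp: z_def x_def norm_mult)
  have T: "theta3 (inverse x) q > 0"
  proof -
    have h: "((\<lambda>k::int. q powi k\<^sup>2 * x powi k) has_sum theta3 (inverse x) q) UNIV"
      by (rule theta3_inverse_has_sum) (use q in \<open>auto simp: x_def\<close>)
    have "sum (\<lambda>k::int. q powi k\<^sup>2 * x powi k) {0} \<le> theta3 (inverse x) q"
      by (rule finite_sum_le_has_sum[OF h]) (use q in \<open>auto simp: x_def\<close>)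
    thus ?thesis by simp
  qed
  obtain e where e:
    "\<And>n. (\<lambda>k. of_real (q ^ k\<^sup>2 / qpoch q q k) * (- (of_real (q powi (- 2 * int n)) * z)) ^ k) sums
      ((- z) ^ n * (theta4 (inverse z) q + e n) / of_real (qpoch_inf q q * q ^ n\<^sup>2))"
    "\<And>n. cmod (e n) \<le> theta3 (inverse (cmod z)) q *
            (q powr (real n / 2) / (1 - q) + q ^ (n div 2)\<^sup>2 / cmod z ^ (n div 2))"
    using ramanujan_A_expansion[OF q z(1)] by blast
  have Nn: "real n / N = real n powr (1 - a)"
    using n by (simp add: N_def powr_diff)
  have "q powi (- 2 * int n) = exp (2 * pi * (real n / N))"
    using q by (subst powr_real_of_int'[symmetric]) (auto simp: powr_def q_def)
  hence arg: "of_real (q powi (- 2 * int n)) * z = of_real (\<sigma> * exp (2 * pi * (u + real n powr (1 - a))))"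
    by (simp add: z_def x_def Nn exp_add distrib_left)
  define S where "S = (- z) ^ n * (theta4 (inverse z) q + e n) / of_real (qpoch_inf q q * q ^ n\<^sup>2)"
  note A = ramanujan_A_of_real[OF e(1)[of n, unfolded arg, folded S_def]]
  \<comment> \<open>Dividing by the positive theta3 leaves a bound free of theta functions. The real
    part suffices because the value of Ramanujan's function at a real argument is real.\<close>
  define \<epsilon> where "\<epsilon> = Re (e n) / theta3 (inverse x) q"
  have "\<bar>Re (e n)\<bar> \<le> theta3 (inverse x) q * G"
    using order_trans[OF abs_Re_le_cmod e(2)[of n]] by (simp only: z(2) G_def)
  hence "\<bar>\<epsilon>\<bar> \<le> G"
    using T by (simp add: \<epsilon>_def abs_divide divide_le_eq mult.commute)
  moreover have "ramanujan_A q (of_real (\<sigma> * exp (2 * pi * (u + real n powr (1 - a))))) = of_real (Re S)"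
    using A by (simp add: of_real_Re)
  moreover have "Re S * qpoch_inf q q = (- \<sigma>) ^ n * exp (pi / N * (N * u + real n)\<^sup>2) / exp (pi * N * u\<^sup>2) *
        (Re (theta4 (inverse z) q) + theta3 (inverse x) q * \<epsilon>)"
  proof -
    have "Re S * qpoch_inf q q = Re (S * of_real (qpoch_inf q q))" by simp
    also have "S * of_real (qpoch_inf q q) = (- z) ^ n / of_real (q ^ n\<^sup>2) * (theta4 (inverse z) q + e n)"
      using qpoch_inf_pos[OF q] q by (simp add: S_def)
    also have "(- z) ^ n / of_real (q ^ n\<^sup>2) = of_real ((- \<sigma>) ^ n * (x ^ n / q ^ n\<^sup>2))"
      unfolding z_def of_real_minus[symmetric] mult_minus_left[symmetric] of_real_power[symmetric]
        power_mult_distrib of_real_divide[symmetric] by simp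
    also have "x ^ n / q ^ n\<^sup>2 = exp (pi / N * (N * u + real n)\<^sup>2) / exp (pi * N * u\<^sup>2)"
    proof -
      have "x ^ n / q ^ n\<^sup>2 = exp (real n * (2 * pi * u) - real (n\<^sup>2) * (- pi / N))"
        unfolding x_def q_def exp_of_nat_mult exp_diff ..
      also have "real n * (2 * pi * u) - real (n\<^sup>2) * (- pi / N) = pi / N * (N * u + real n)\<^sup>2 - pi * N * u\<^sup>2"
        using N by (simp add: power2_eq_square field_simps)
      finally show ?thesis by (simp only: exp_diff)
    qed
    finally show ?thesis using T by (simp add: \<epsilon>_def)
  qed
  ultimately show thesis using that[of "Re S" \<epsilon>] by (simp only: G_def x_def z_def)
qed

text \<open>The negative sign of the argument cancels the alternating signs, so in the first formula
  theta3 is both the main term and the scale of the remainder.\<close>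

lemma theta4_minus_inverse:
  fixes q x :: real
  assumes "0 < q" "q < 1" "0 < x"
  shows "theta4 (inverse (complex_of_real (- x))) q = of_real (theta3 (inverse x) q)"
proof -
  have "((\<lambda>k::int. complex_of_real (q powi k\<^sup>2) * (- of_real (- x)) powi k) has_sum theta4 (inverse (complex_of_real (- x))) q) UNIV"
    by (rule theta4_inverse_has_sum) (use assms in auto)
  moreover have "((\<lambda>k::int. complex_of_real (q powi k\<^sup>2 * x powi k)) has_sum of_real (theta3 (inverse x) q)) UNIV"
    by (intro has_sum_of_real theta3_inverse_has_sum assms)
  ultimately show ?thesis using has_sum_unique by simp
qed

lemma eventually_exp_small:
  assumes "c > 0"
  shows "\<forall>\<^sub>F n in sequentially. C * exp (- c * real n powr a) \<le> 1 / 2"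
proof -
  have "(\<lambda>n. exp (- c * real n powr a)) \<longlonglongrightarrow> 0" using a assms by real_asymp
  from tendsto_mult_left[OF this, of C] have "(\<lambda>n. C * exp (- c * real n powr a)) \<longlonglongrightarrow> 0" by simp
  from order_tendstoD(2)[OF this, of "1 / 2"] show ?thesis by (auto elim: eventually_mono)
qed

lemma ramanujan_A_negative_asymptotics:
  "\<exists>r :: nat \<Rightarrow> real. r \<in> O(\<lambda>n. exp (- pi * real n powr a)) \<and>
        (\<forall>n\<ge>1.
          ramanujan_A (exp (- pi * real n powr (- a)))
              (- complex_of_real (exp (2 * pi * (u + real n powr (1 - a))))) =
            complex_of_real
              (exp (pi * real n powr (- a) * (real n powr a * u + real n)\<^sup>2) * (1 + r n) /
               (sqrt 2 * exp (pi * real n powr (- a) / 24 - pi * real n powr a / 6))))"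
proof -
  define N where "N n = real n powr a" for n
  define q where "q n = exp (- pi / N n)" for n
  define y where "y n = - complex_of_real (exp (2 * pi * (u + real n powr (1 - a))))" for n
  define F where "F n = sqrt 2 * exp (pi / N n / 24 - pi * N n / 6)" for n
  define E where "E n = exp (pi / N n * (N n * u + real n)\<^sup>2)" for n
  \<comment> \<open>Solving the asserted formula for the error makes it an identity for every n >=
    1, since the value is real; only the size of \<open>r\<close> remains to be estimated.\<close>
  define r where "r n = Re (ramanujan_A (q n) (y n)) * F n / E n - 1" for n
  have FE: "F n > 0" "E n > 0" for n by (simp_all add: F_def E_def)
  obtain CA where CA: "CA \<ge> 0" "\<And>N u. N \<ge> 1 \<Longrightarrow> \<exists>\<alpha>. \<bar>\<alpha>\<bar> \<le> CA * exp (- pi * N) \<and>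
      theta3 (inverse (exp (2 * pi * u))) (exp (- pi / N)) = exp (pi * N * u\<^sup>2) * sqrt N * (1 + \<alpha>)"
    using theta3_asymptotics by blast
  obtain CB where CB: "CB \<ge> 0" "\<And>N. N \<ge> 1 \<Longrightarrow> \<exists>\<beta>. \<bar>\<beta>\<bar> \<le> CB * exp (- 4 * pi * N) \<and>
      qpoch_inf (exp (- pi / N)) (exp (- pi / N)) =
        sqrt 2 * sqrt N * exp (pi / N / 24 - pi * N / 6) * (1 + \<beta>)"
    using qpoch_inf_asymptotics by blast
  have main: "ramanujan_A (q n) (y n) = of_real (E n * (1 + r n) / F n)" if n: "n \<ge> 1" for n
  proof -
    obtain A where "ramanujan_A (q n) (y n) = of_real A"
      using ramanujan_A_at_exp[OF n, of "-1"] by (auto simp: q_def N_def y_def)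
    thus ?thesis using FE[of n] by (simp add: r_def)
  qed
  have "r \<in> O(\<lambda>n. exp (- pi * N n))"
  proof (rule bigoI)
    have small: "\<forall>\<^sub>F n in sequentially. CB * exp (- 4 * pi * N n) \<le> 1 / 2"
      using eventually_exp_small[of "4 * pi" CB] by (simp add: N_def)
    from eventually_ge_at_top[of 1] eventually_remainder_bound[OF a, of u] small
    show "\<forall>\<^sub>F n in sequentially. norm (r n) \<le> (2 * (3 * CA + 2 + CB)) * norm (exp (- pi * N n))"
    proof eventually_elim
      case (elim n)
      have N1: "N n \<ge> 1" unfolding N_def using a elim(1) by (intro ge_one_powr_ge_zero) auto
      define e1 where "e1 = exp (- pi * N n)"
      have e1: "0 < e1" "e1 \<le> 1" using N1 by (simp_all add: e1_def)
      obtain A \<epsilon> where A: "ramanujan_A (q n) (y n) = of_real A"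
          "A * qpoch_inf (q n) (q n) = E n / exp (pi * N n * u\<^sup>2) *
             (theta3 (inverse (exp (2 * pi * u))) (q n) + theta3 (inverse (exp (2 * pi * u))) (q n) * \<epsilon>)"
          "\<bar>\<epsilon>\<bar> \<le> 2 * exp (- 3 * pi * N n)"
      proof (rule ramanujan_A_at_exp[of n "-1"])
        fix A \<epsilon>
        assume *: "ramanujan_A (exp (- pi / real n powr a)) (complex_of_real (- 1 * exp (2 * pi * (u + real n powr (1 - a))))) = complex_of_real A"
          "A * qpoch_inf (exp (- pi / real n powr a)) (exp (- pi / real n powr a)) =
            (- (- 1)) ^ n * exp (pi / real n powr a * (real n powr a * u + real n)\<^sup>2) / exp (pi * real n powr a * u\<^sup>2) *
            (Re (theta4 (inverse (complex_of_real (- 1 * exp (2 * pi * u)))) (exp (- pi / real n powr a))) +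
             theta3 (inverse (exp (2 * pi * u))) (exp (- pi / real n powr a)) * \<epsilon>)"
          "\<bar>\<epsilon>\<bar> \<le> exp (- pi / real n powr a) powr (real n / 2) / (1 - exp (- pi / real n powr a)) +
            exp (- pi / real n powr a) ^ (n div 2)\<^sup>2 / exp (2 * pi * u) ^ (n div 2)"
        have "theta4 (inverse (complex_of_real (- 1 * exp (2 * pi * u)))) (exp (- pi / real n powr a)) =
            of_real (theta3 (inverse (exp (2 * pi * u))) (exp (- pi / real n powr a)))"
          using theta4_minus_inverse[of "exp (- pi / real n powr a)" "exp (2 * pi * u)"] elim(1)
          by (simp only: mult_minus_left mult_1) simp
        with * show ?thesis
          using order_trans[OF *(3) elim(2)] by (intro that[of A \<epsilon>]) (simp_all add: q_def N_def y_def E_def)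
      qed (use elim(1) in auto)
      obtain \<alpha> where \<alpha>: "\<bar>\<alpha>\<bar> \<le> CA * e1"
          "theta3 (inverse (exp (2 * pi * u))) (q n) = exp (pi * N n * u\<^sup>2) * sqrt (N n) * (1 + \<alpha>)"
        using CA(2)[OF N1] by (auto simp: q_def e1_def)
      obtain \<beta> where \<beta>: "\<bar>\<beta>\<bar> \<le> CB * exp (- 4 * pi * N n)" "qpoch_inf (q n) (q n) = sqrt (N n) * F n * (1 + \<beta>)"
        using CB(2)[OF N1] by (auto simp: q_def F_def mult_ac)
      have \<beta>h: "\<bar>\<beta>\<bar> \<le> 1 / 2" using \<beta>(1) elim(3) by (simp add: N_def)
      have b: "1 + \<beta> > 0" using \<beta>h by linarith
      \<comment> \<open>The factor exp(pi N u^2) of theta3 cancels the one in the prefactor, and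
        sqrt N is common to theta3 and (q;q)_inf. What remains is 1 + r =
        (1+\<alpha>)(1+\<epsilon>)/(1+\<beta>), where \<alpha> has the largest guaranteed error
        rate, exp(-pi N).\<close>
      have "sqrt (N n) * (A * F n * (1 + \<beta>)) = sqrt (N n) * (E n * ((1 + \<alpha>) * (1 + \<epsilon>)))"
        using A(2) unfolding \<alpha> \<beta> by (simp add: algebra_simps)
      hence "A * F n * (1 + \<beta>) = E n * ((1 + \<alpha>) * (1 + \<epsilon>))" using N1 by simp
      hence "A * F n / E n = (1 + \<alpha>) * (1 + \<epsilon>) / (1 + \<beta>)" using FE[of n] b by (simp add: field_simps)
      hence "r n = (\<alpha> + \<epsilon> + \<alpha> * \<epsilon> - \<beta>) / (1 + \<beta>)" using b by (simp add: r_def A(1) field_simps)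
      hence 1: "\<bar>r n\<bar> \<le> 2 * \<bar>\<alpha> + \<epsilon> + \<alpha> * \<epsilon> - \<beta>\<bar>"
        using abs_inverse_one_plus_le[OF \<beta>h] by simp
      have \<beta>1: "\<bar>\<beta>\<bar> \<le> CB * e1"
        using \<beta>(1) by (rule order_trans) (use CB(1) N1 in \<open>auto simp: e1_def intro!: mult_left_mono\<close>)
      have \<epsilon>1: "\<bar>\<epsilon>\<bar> \<le> 2 * e1"
        using A(3) by (rule order_trans) (use N1 in \<open>auto simp: e1_def\<close>)
      have "\<bar>\<alpha> * \<epsilon>\<bar> \<le> CA * (2 * e1)"
        unfolding abs_mult
      proof (rule mult_mono[OF _ \<epsilon>1])
        show "\<bar>\<alpha>\<bar> \<le> CA" using \<alpha>(1) mult_left_le[OF e1(2) CA(1)] by linarith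
      qed (use CA in auto)
      moreover have "\<bar>\<alpha> + \<epsilon> + \<alpha> * \<epsilon> - \<beta>\<bar> \<le> \<bar>\<alpha>\<bar> + \<bar>\<epsilon>\<bar> + \<bar>\<alpha> * \<epsilon>\<bar> + \<bar>\<beta>\<bar>" by linarith
      ultimately have 2: "\<bar>\<alpha> + \<epsilon> + \<alpha> * \<epsilon> - \<beta>\<bar> \<le> CA * e1 + 2 * e1 + CA * (2 * e1) + CB * e1"
        using \<alpha>(1) \<beta>1 \<epsilon>1 by linarith
      have "\<bar>r n\<bar> \<le> 2 * (CA * e1 + 2 * e1 + CA * (2 * e1) + CB * e1)"
        by (rule order_trans[OF 1 mult_left_mono[OF 2]]) simp
      also have "\<dots> = (2 * (3 * CA + 2 + CB)) * e1" by (simp add: algebra_simps)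
      finally show ?case by (simp add: e1_def)
    qed
  qed
  moreover have pw: "real n powr (- a) = 1 / N n" for n
    by (simp add: N_def powr_minus divide_inverse)
  ultimately show ?thesis using main
    unfolding q_def y_def E_def F_def pw N_def[symmetric] times_divide_eq_right mult_1_right by blast
qed

text \<open>Here the main term is theta4 while the remainder is scaled by theta3. The error is kept
  additive to the cosine, r = (c + \<gamma> + \<delta>)/(1+\<beta>) - c, since dividing by a cosine
  that may vanish is impossible.\<close>

lemma ramanujan_A_positive_asymptotics:
  "\<exists>r :: nat \<Rightarrow> real. r \<in> O(\<lambda>n. exp (- 2 * pi * real n powr a)) \<and>
        (\<forall>n\<ge>1.
          ramanujan_A (exp (- pi * real n powr (- a)))
              (complex_of_real (exp (2 * pi * (u + real n powr (1 - a))))) =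
            complex_of_real
              (sqrt 2 * exp (pi * real n powr (- a) * (real n powr a * u + real n)\<^sup>2) *
                 (cos (pi * real n powr a * u) + r n) /
               ((- 1) ^ n * exp (pi * (real n powr a / 12 + real n powr (- a) / 24)))))"
proof -
  define N where "N n = real n powr a" for n
  define q where "q n = exp (- pi / N n)" for n
  define y where "y n = complex_of_real (exp (2 * pi * (u + real n powr (1 - a))))" for n
  define F where "F n = sqrt 2 * exp (pi / N n / 24 - pi * N n / 6)" for n
  define D where "D n = exp (pi * (N n / 12 + 1 / N n / 24))" for n
  define E where "E n = exp (pi / N n * (N n * u + real n)\<^sup>2)" for n
  define c where "c n = cos (pi * N n * u)" for n
  define r where "r n = Re (ramanujan_A (q n) (y n)) * ((- 1) ^ n * D n) / (sqrt 2 * E n) - c n" for n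
  have pos: "F n > 0" "E n > 0" "D n > 0" for n by (simp_all add: F_def E_def D_def)
  have sgn: "(- 1 :: real) ^ n * (- 1) ^ n = 1" for n by (simp flip: power_mult_distrib)
  obtain CA where CA: "CA \<ge> 0" "\<And>N u. N \<ge> 1 \<Longrightarrow> \<exists>\<alpha>. \<bar>\<alpha>\<bar> \<le> CA * exp (- pi * N) \<and>
      theta3 (inverse (exp (2 * pi * u))) (exp (- pi / N)) = exp (pi * N * u\<^sup>2) * sqrt N * (1 + \<alpha>)"
    using theta3_asymptotics by blast
  obtain CB where CB: "CB \<ge> 0" "\<And>N. N \<ge> 1 \<Longrightarrow> \<exists>\<beta>. \<bar>\<beta>\<bar> \<le> CB * exp (- 4 * pi * N) \<and>
      qpoch_inf (exp (- pi / N)) (exp (- pi / N)) =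
        sqrt 2 * sqrt N * exp (pi / N / 24 - pi * N / 6) * (1 + \<beta>)"
    using qpoch_inf_asymptotics by blast
  obtain CG where CG: "CG \<ge> 0" "\<And>N u. N \<ge> 1 \<Longrightarrow> \<exists>\<gamma>. \<bar>\<gamma>\<bar> \<le> CG * exp (- 2 * pi * N) \<and>
      theta4 (inverse (complex_of_real (exp (2 * pi * u)))) (exp (- pi / N)) =
        of_real (exp (pi * N * u\<^sup>2) * sqrt N * (2 * exp (- pi * N / 4) * (cos (pi * N * u) + \<gamma>)))"
    using theta4_asymptotics by blast
  have main: "ramanujan_A (q n) (y n) = of_real (sqrt 2 * E n * (c n + r n) / ((- 1) ^ n * D n))" if n: "n \<ge> 1" for n
  proof -
    obtain A where "ramanujan_A (q n) (y n) = of_real A"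
      using ramanujan_A_at_exp[OF n, of 1] by (auto simp: q_def N_def y_def)
    thus ?thesis using pos[of n] by (simp add: r_def)
  qed
  have "r \<in> O(\<lambda>n. exp (- 2 * pi * N n))"
  proof (rule bigoI)
    have small: "\<forall>\<^sub>F n in sequentially. CB * exp (- 4 * pi * N n) \<le> 1 / 2"
      using eventually_exp_small[of "4 * pi" CB] by (simp add: N_def)
    from eventually_ge_at_top[of 1] eventually_remainder_bound[OF a, of u] small
    show "\<forall>\<^sub>F n in sequentially. norm (r n) \<le> (2 * (CG + (1 + CA) + CB)) * norm (exp (- 2 * pi * N n))"
    proof eventually_elim
      case (elim n)
      have N1: "N n \<ge> 1" unfolding N_def using a elim(1) by (intro ge_one_powr_ge_zero) auto
      define e2 where "e2 = exp (- 2 * pi * N n)"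
      define h where "h = exp (- pi * N n / 4)"
      have e2: "0 < e2" "e2 \<le> 1" using N1 by (simp_all add: e2_def)
      have h: "h > 0" by (simp add: h_def)
      obtain A \<epsilon> where A: "ramanujan_A (q n) (y n) = of_real A"
          "A * qpoch_inf (q n) (q n) = (- 1) ^ n * E n / exp (pi * N n * u\<^sup>2) *
             (Re (theta4 (inverse (complex_of_real (exp (2 * pi * u)))) (q n)) + theta3 (inverse (exp (2 * pi * u))) (q n) * \<epsilon>)"
          "\<bar>\<epsilon>\<bar> \<le> 2 * exp (- 3 * pi * N n)"
      proof (rule ramanujan_A_at_exp[of n 1])
        fix A \<epsilon>
        assume *: "ramanujan_A (exp (- pi / real n powr a)) (complex_of_real (1 * exp (2 * pi * (u + real n powr (1 - a))))) = complex_of_real A"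
          "A * qpoch_inf (exp (- pi / real n powr a)) (exp (- pi / real n powr a)) =
            (- 1) ^ n * exp (pi / real n powr a * (real n powr a * u + real n)\<^sup>2) / exp (pi * real n powr a * u\<^sup>2) *
            (Re (theta4 (inverse (complex_of_real (1 * exp (2 * pi * u)))) (exp (- pi / real n powr a))) +
             theta3 (inverse (exp (2 * pi * u))) (exp (- pi / real n powr a)) * \<epsilon>)"
          "\<bar>\<epsilon>\<bar> \<le> exp (- pi / real n powr a) powr (real n / 2) / (1 - exp (- pi / real n powr a)) +
            exp (- pi / real n powr a) ^ (n div 2)\<^sup>2 / exp (2 * pi * u) ^ (n div 2)"
        show ?thesis
          using * order_trans[OF *(3) elim(2)] by (intro that[of A \<epsilon>]) (simp_all add: q_def N_def y_def E_def)
      qed (use elim(1) in auto)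
      obtain \<alpha> where \<alpha>: "\<bar>\<alpha>\<bar> \<le> CA * exp (- pi * N n)"
          "theta3 (inverse (exp (2 * pi * u))) (q n) = exp (pi * N n * u\<^sup>2) * sqrt (N n) * (1 + \<alpha>)"
        using CA(2)[OF N1] by (auto simp: q_def)
      obtain \<gamma> where \<gamma>: "\<bar>\<gamma>\<bar> \<le> CG * e2"
          "Re (theta4 (inverse (complex_of_real (exp (2 * pi * u)))) (q n)) =
            exp (pi * N n * u\<^sup>2) * sqrt (N n) * (2 * h * (c n + \<gamma>))"
      proof -
        obtain \<gamma> where "\<bar>\<gamma>\<bar> \<le> CG * exp (- 2 * pi * N n)"
          "theta4 (inverse (complex_of_real (exp (2 * pi * u)))) (exp (- pi / N n)) =
            of_real (exp (pi * N n * u\<^sup>2) * sqrt (N n) * (2 * exp (- pi * N n / 4) * (cos (pi * N n * u) + \<gamma>)))"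
          using CG(2)[OF N1, of u] by blast
        thus ?thesis by (intro that[of \<gamma>]) (simp_all only: q_def e2_def h_def c_def Re_complex_of_real)
      qed
      obtain \<beta> where \<beta>: "\<bar>\<beta>\<bar> \<le> CB * exp (- 4 * pi * N n)" "qpoch_inf (q n) (q n) = sqrt (N n) * F n * (1 + \<beta>)"
        using CB(2)[OF N1] by (auto simp: q_def F_def mult_ac)
      have \<beta>h: "\<bar>\<beta>\<bar> \<le> 1 / 2" using \<beta>(1) elim(3) by (simp add: N_def)
      have b: "1 + \<beta> > 0" using \<beta>h by linarith
      \<comment> \<open>The remainder relative to the theta4 amplitude 2h: \<open>h\<close> is the
        factor exp(-pi N/4) that theta4 has and theta3 lacks.\<close>
      define \<delta> where "\<delta> = (1 + \<alpha>) * (\<epsilon> / (2 * h))"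
      have "sqrt (N n) * (A * F n * (1 + \<beta>)) =
          sqrt (N n) * ((- 1) ^ n * E n * (2 * h * (c n + \<gamma>) + (1 + \<alpha>) * \<epsilon>))"
        using A(2) unfolding \<alpha> \<beta> \<gamma> by (simp add: algebra_simps)
      moreover have "(1 + \<alpha>) * \<epsilon> = 2 * h * \<delta>" using h by (simp add: \<delta>_def)
      moreover have "2 * h * (c n + \<gamma>) + 2 * h * \<delta> = 2 * h * (c n + \<gamma> + \<delta>)" by (simp only: distrib_left)
      ultimately have "sqrt (N n) * (A * F n * (1 + \<beta>)) =
          sqrt (N n) * ((- 1) ^ n * E n * (2 * h * (c n + \<gamma> + \<delta>)))" by (simp only:)
      hence AF: "A * F n * (1 + \<beta>) = (- 1) ^ n * E n * (2 * h * (c n + \<gamma> + \<delta>))"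
        using N1 by simp
      \<comment> \<open>The identity 1/12 - 1/4 = -1/6: the exponential decay of theta4 combines
        with that of (q;q)_inf to the exponent pi N/12 of the stated denominator. The amplitude 2 of
        theta4 over the \<open>sqrt 2\<close> of (q;q)_inf gives the \<open>sqrt 2\<close> in the
        numerator.\<close>
      have "D n * h = exp (pi / N n / 24 - pi * N n / 6)"
        by (simp add: D_def h_def algebra_simps flip: exp_add)
      hence FD: "F n = sqrt 2 * (D n * h)" by (simp only: F_def)
      have "A * ((- 1) ^ n * D n) * (sqrt 2 * h * (1 + \<beta>)) = (- 1) ^ n * (A * F n * (1 + \<beta>))"
        unfolding FD by (simp only: mult_ac)
      also have "\<dots> = ((- 1) ^ n * (- 1) ^ n) * (E n * (2 * h * (c n + \<gamma> + \<delta>)))"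
        unfolding AF by (simp only: mult_ac)
      also have "\<dots> = (sqrt 2 * sqrt 2) * (E n * (h * (c n + \<gamma> + \<delta>)))"
        unfolding sgn by simp
      finally have "(A * ((- 1) ^ n * D n) * (1 + \<beta>)) * (sqrt 2 * h) = ((c n + \<gamma> + \<delta>) * (sqrt 2 * E n)) * (sqrt 2 * h)"
        by (simp only: mult_ac)
      hence "A * ((- 1) ^ n * D n) * (1 + \<beta>) = (c n + \<gamma> + \<delta>) * (sqrt 2 * E n)" using h by simp
      hence "A * ((- 1) ^ n * D n) / (sqrt 2 * E n) = (c n + \<gamma> + \<delta>) / (1 + \<beta>)"
        using pos(2)[of n] b by (simp add: frac_eq_eq)
      hence "r n = (c n + \<gamma> + \<delta>) / (1 + \<beta>) - c n" by (simp add: r_def A(1))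
      also have "\<dots> = (\<gamma> + \<delta> - \<beta> * c n) / (1 + \<beta>)" using b by (simp add: field_simps)
      finally have 1: "\<bar>r n\<bar> \<le> 2 * \<bar>\<gamma> + \<delta> - \<beta> * c n\<bar>"
        using abs_inverse_one_plus_le[OF \<beta>h] by simp
      have "\<bar>\<beta> * c n\<bar> \<le> CB * e2"
      proof -
        have "\<bar>\<beta> * c n\<bar> \<le> \<bar>\<beta>\<bar>" unfolding abs_mult c_def by (intro mult_left_le) auto
        also have "\<bar>\<beta>\<bar> \<le> CB * e2"
          using \<beta>(1) by (rule order_trans) (use CB(1) N1 in \<open>auto simp: e2_def intro!: mult_left_mono\<close>)
        finally show ?thesis .
      qed
      moreover have "\<bar>\<delta>\<bar> \<le> (1 + CA) * e2"
      proof -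
        have "\<bar>\<epsilon>\<bar> \<le> e2 * (2 * h)"
        proof -
          \<comment> \<open>Uses 3 >= 2 + 1/4, the reason for the rate 3 pi in the remainder
            bound.\<close>
          have "exp (- 3 * pi * N n) \<le> exp (- 2 * pi * N n + - pi * N n / 4)" using N1 by simp
          hence "exp (- 3 * pi * N n) \<le> e2 * h" by (simp only: exp_add e2_def h_def)
          thus ?thesis using A(3) by simp
        qed
        hence 1: "\<bar>\<epsilon> / (2 * h)\<bar> \<le> e2" using h by (simp add: abs_divide divide_le_eq)
        have "CA * exp (- pi * N n) \<le> CA" using CA(1) N1 by (intro mult_left_le) auto
        hence 2: "\<bar>1 + \<alpha>\<bar> \<le> 1 + CA" using \<alpha>(1) by linarith
        show ?thesis unfolding \<delta>_def abs_mult using CA(1) by (intro mult_mono[OF 2 1]) auto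
      qed
      moreover have "\<bar>\<gamma> + \<delta> - \<beta> * c n\<bar> \<le> \<bar>\<gamma>\<bar> + \<bar>\<delta>\<bar> + \<bar>\<beta> * c n\<bar>" by linarith
      ultimately have 2: "\<bar>\<gamma> + \<delta> - \<beta> * c n\<bar> \<le> CG * e2 + (1 + CA) * e2 + CB * e2"
        using \<gamma>(1) by linarith
      have "\<bar>r n\<bar> \<le> 2 * (CG * e2 + (1 + CA) * e2 + CB * e2)"
        by (rule order_trans[OF 1 mult_left_mono[OF 2]]) simp
      also have "\<dots> = (2 * (CG + (1 + CA) + CB)) * e2" by (simp add: algebra_simps)
      finally show ?case by (simp add: e2_def)
    qed
  qed
  moreover have pw: "real n powr (- a) = 1 / N n" for n
    by (simp add: N_def powr_minus divide_inverse)
  ultimately show ?thesis using main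
    unfolding q_def y_def E_def D_def c_def pw N_def[symmetric] times_divide_eq_right mult_1_right by blast
qed

end


text \<open>The equivalence with \<open>w = e n\<close> encodes that the displayed equation defines
  e(n): exactly one value satisfies it. The O-terms of part (ii) appear as explicit error functions
  \<open>r\<close>, and \<open>n div 2\<close> is the integer part of n/2.\<close>

theorem theorem2p3:
  "(\<forall>(q::real) (z::complex). 0 < q \<and> q < 1 \<and> z \<noteq> 0 \<longrightarrow>
      (\<exists>e :: nat \<Rightarrow> complex.
        (\<forall>n w.
          ramanujan_A q (complex_of_real (q powi (- 2 * int n)) * z) =
            (- z) ^ n * (theta4 (inverse z) q + w) / complex_of_real (qpoch_inf q q * q ^ n\<^sup>2)
          \<longleftrightarrow> w = e n) \<and>
        (\<forall>\<^sub>F n in sequentially.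
          cmod (e n) \<le> 4 * theta3 (inverse (cmod z)) q *
            (q powr (real n / 2) / (1 - q) + q ^ (n div 2)\<^sup>2 / cmod z ^ (n div 2))))) \<and>
   (\<forall>(a::real) (u::real). 0 < a \<and> a < 1 / 2 \<longrightarrow>
      (\<exists>r :: nat \<Rightarrow> real. r \<in> O(\<lambda>n. exp (- pi * real n powr a)) \<and>
        (\<forall>n\<ge>1.
          ramanujan_A (exp (- pi * real n powr (- a)))
              (- complex_of_real (exp (2 * pi * (u + real n powr (1 - a))))) =
            complex_of_real
              (exp (pi * real n powr (- a) * (real n powr a * u + real n)\<^sup>2) * (1 + r n) /
               (sqrt 2 * exp (pi * real n powr (- a) / 24 - pi * real n powr a / 6))))) \<and>
      (\<exists>r :: nat \<Rightarrow> real. r \<in> O(\<lambda>n. exp (- 2 * pi * real n powr a)) \<and>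
        (\<forall>n\<ge>1.
          ramanujan_A (exp (- pi * real n powr (- a)))
              (complex_of_real (exp (2 * pi * (u + real n powr (1 - a))))) =
            complex_of_real
              (sqrt 2 * exp (pi * real n powr (- a) * (real n powr a * u + real n)\<^sup>2) *
                 (cos (pi * real n powr a * u) + r n) /
               ((- 1) ^ n * exp (pi * (real n powr a / 12 + real n powr (- a) / 24)))))))"
proof (intro conjI allI impI)
  fix q :: real and z :: complex
  assume A: "0 < q \<and> q < 1 \<and> z \<noteq> 0"
  hence q: "0 < q" "q < 1" and z: "z \<noteq> 0" by auto
  obtain e where e:
    "\<And>n. (\<lambda>k. of_real (q ^ k\<^sup>2 / qpoch q q k) * (- (of_real (q powi (- 2 * int n)) * z)) ^ k) sums
      ((- z) ^ n * (theta4 (inverse z) q + e n) / of_real (qpoch_inf q q * q ^ n\<^sup>2))"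
    "\<And>n. cmod (e n) \<le> theta3 (inverse (cmod z)) q *
            (q powr (real n / 2) / (1 - q) + q ^ (n div 2)\<^sup>2 / cmod z ^ (n div 2))"
    using ramanujan_A_expansion[OF q z] by blast
  have eq: "ramanujan_A q (complex_of_real (q powi (- 2 * int n)) * z) =
      (- z) ^ n * (theta4 (inverse z) q + e n) / complex_of_real (qpoch_inf q q * q ^ n\<^sup>2)" for n
    unfolding ramanujan_A_def using e(1) by (rule sums_unique[symmetric])
  have nz: "complex_of_real (qpoch_inf q q * q ^ n\<^sup>2) \<noteq> 0" "(- z) ^ n \<noteq> 0" for n
    using qpoch_inf_pos[OF q] q z by auto
  \<comment> \<open>A nonzero prefactor and denominator make the right-hand side injective in w,
    which gives uniqueness of the error value.\<close>
  have "x * (t + s) / d = x * (t + w) / d \<longleftrightarrow> w = s" if "d \<noteq> 0" "x \<noteq> 0" for x t s w d :: complex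
    using that by auto
  note unique = this[OF nz]
  have "cmod (e n) \<le> 4 * theta3 (inverse (cmod z)) q *
            (q powr (real n / 2) / (1 - q) + q ^ (n div 2)\<^sup>2 / cmod z ^ (n div 2))" for n
    using e(2)[of n] norm_ge_zero[of "e n"] by linarith
  thus "\<exists>e :: nat \<Rightarrow> complex.
        (\<forall>n w.
          ramanujan_A q (complex_of_real (q powi (- 2 * int n)) * z) =
            (- z) ^ n * (theta4 (inverse z) q + w) / complex_of_real (qpoch_inf q q * q ^ n\<^sup>2)
          \<longleftrightarrow> w = e n) \<and>
        (\<forall>\<^sub>F n in sequentially.
          cmod (e n) \<le> 4 * theta3 (inverse (cmod z)) q *
            (q powr (real n / 2) / (1 - q) + q ^ (n div 2)\<^sup>2 / cmod z ^ (n div 2)))"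
    unfolding eq unique by (intro exI[of _ e]) simp
qed (rule ramanujan_A_negative_asymptotics ramanujan_A_positive_asymptotics; simp)+

end
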